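(* Fix $0<\mathfrak d\in\mathbb R$. (1) $\hat\Phi(\mathfrak s)\le\hat\Phi(\mathfrak s+1)$ for $\mathfrak s\in\mathbb R$ with $\frac{\mathfrak d}2\le\mathfrak s<\mathfrak d-1$. (2) $\Phi(\mathfrak s)\le\Phi(\mathfrak s+1)$ for $\mathfrak s,\mathfrak d\in\frac12\mathbb N$ with $\frac{\mathfrak d}2\le\mathfrak s<\mathfrak d-1$.
   Context: $\frac12\mathbb N=\{n/2:n\in\mathbb N\}$, $\mathbb N=\{1,2,\dots\}$. $I_x(\alpha,\beta)$ denotes the regularized incomplete beta function, i.e. the CDF $P^{b(\alpha,\beta)}(\mathfrak B\le x)$ of a Beta$(\alpha,\beta)$ distributed random variable $\mathfrak B$. For fixed $\mathfrak d>0$ and $0<\mathfrak s<\mathfrak d$, $$\Phi(\mathfrak s):=P^{b(\mathfrak s,\mathfrak d-\mathfrak s+1)}(\mathfrak B\le e_{\mathfrak s,\mathfrak d-\mathfrak s})=I_{e_{\mathfrak s,\mathfrak d-\mathfrak s}}(\mathfrak s,\mathfrak d-\mathfrak s+1),\qquad\hat\Phi(\mathfrak s):=P^{b(\mathfrak s,\mathfrak d-\mathfrak s+1)}\left(\mathfrak B\le\tfrac{\mathfrak s}{\mathfrak d}\right)=I_{\frac{\mathfrak s}{\mathfrak d}}(\mathfrak s,\mathfrak d-\mathfrak s+1).$$ For real $\mathfrak s,\mathfrak t>0$ the equipoint $e_{\mathfrak s,\mathfrak t}\in[0,1]$ is the unique number satisfying $I_{e_{\mathfrak s,\mathfrak t}}(\mathfrak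 s,\mathfrak t+1)+I_{e_{\mathfrak s,\mathfrak t}}(\mathfrak s+1,\mathfrak t)=1$. *)

theory Defs
  imports "HOL-Probability.Probability"
begin

text \<open>The restriction to the open interval is immaterial (endpoints are null) and keeps
  \<^const>\<open>powr\<close> on positive bases.\<close>

definition beta_density :: "real \<Rightarrow> real \<Rightarrow> real \<Rightarrow> real" where
  "beta_density \<alpha> \<beta> x =
     (if 0 < x \<and> x < 1 then x powr (\<alpha> - 1) * (1 - x) powr (\<beta> - 1) / Beta \<alpha> \<beta> else 0)"

definition beta_distr :: "real \<Rightarrow> real \<Rightarrow> real measure" where
  "beta_distr \<alpha> \<beta> = density lborel (\<lambda>x. ennreal (beta_density \<alpha> \<beta> x))"

definition reg_inc_beta :: "real \<Rightarrow> real \<Rightarrow> real \<Rightarrow> real" where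
  "reg_inc_beta x \<alpha> \<beta> = cdf (beta_distr \<alpha> \<beta>) x"

text \<open>For \<open>s, t > 0\<close> the description below is proper, see \<open>ex1_equipoint\<close>.\<close>

definition equipoint :: "real \<Rightarrow> real \<Rightarrow> real" where
  "equipoint s t =
     (THE x. x \<in> {0..1} \<and> reg_inc_beta x s (t + 1) + reg_inc_beta x (s + 1) t = 1)"

text \<open>\<open>Phi\<close> and \<open>Phi_hat\<close> are meaningful for \<open>0 < s < d\<close> only.\<close>

definition Phi :: "real \<Rightarrow> real \<Rightarrow> real" where
  "Phi d s = reg_inc_beta (equipoint s (d - s)) s (d - s + 1)"

definition Phi_hat :: "real \<Rightarrow> real \<Rightarrow> real" where
  "Phi_hat d s = reg_inc_beta (s / d) s (d - s + 1)"

text \<open>Positive half-integers: \<open>\<nat>\<close> starts at 1 here.\<close>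

definition half_Nats :: "real set" where
  "half_Nats = {real n / 2 | n. 1 \<le> n}"

lemma borel_measurable_beta_density [measurable]:
  "beta_density \<alpha> \<beta> \<in> borel_measurable borel"
  unfolding beta_density_def by measurable

lemma beta_density_nonneg:
  assumes "\<alpha> > 0" "\<beta> > 0"
  shows "beta_density \<alpha> \<beta> x \<ge> 0"
  using assms by (auto simp: beta_density_def Beta_def Gamma_real_pos intro!: divide_nonneg_pos divide_pos_pos mult_pos_pos)

lemma prob_space_beta_distr:
  assumes "\<alpha> > 0" "\<beta> > 0"
  shows "prob_space (beta_distr \<alpha> \<beta>)"
proof
  have pos: "Beta \<alpha> \<beta> > 0"
    using assms by (auto simp: Beta_def Gamma_real_pos intro!: divide_pos_pos mult_pos_pos)
  have "((\<lambda>x. x powr (\<alpha> - 1) * (1 - x) powr (\<beta> - 1)) has_integral Beta \<alpha> \<beta>) {0..1}"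
    using has_integral_Beta_real[OF assms] .
  from has_integral_divide[OF this, of "Beta \<alpha> \<beta>"] pos
  have "((\<lambda>x. x powr (\<alpha> - 1) * (1 - x) powr (\<beta> - 1) / Beta \<alpha> \<beta>) has_integral 1) {0..1}"
    by simp
  then have "(beta_density \<alpha> \<beta> has_integral 1) {0..1}"
    by (rule has_integral_spike_finite[where S = "{0, 1}", rotated 2])
       (auto simp: beta_density_def)
  then have "(beta_density \<alpha> \<beta> has_integral 1) UNIV"
    by (rule has_integral_on_superset) (auto simp: beta_density_def)
  then have "(\<integral>\<^sup>+x. ennreal (beta_density \<alpha> \<beta> x) \<partial>lborel) = ennreal 1"
    by (intro nn_integral_has_integral_lborel beta_density_nonneg assms) auto
  then show "emeasure (beta_distr \<alpha> \<beta>) (space (beta_distr \<alpha> \<beta>)) = 1"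
    by (simp add: beta_distr_def emeasure_density)
qed

lemma cdf_beta_distr_strict_mono:
  assumes "\<alpha> > 0" "\<beta> > 0" "0 \<le> x" "x < y" "y \<le> 1"
  shows "cdf (beta_distr \<alpha> \<beta>) x < cdf (beta_distr \<alpha> \<beta>) y"
proof -
  interpret prob_space "beta_distr \<alpha> \<beta>" using prob_space_beta_distr assms by blast
  interpret finite_borel_measure "beta_distr \<alpha> \<beta>"
    by standard (simp add: beta_distr_def)
  have "\<not> (AE u in lborel. \<not> (u \<in> {x<..<y}))"
  proof
    assume "AE u in lborel. \<not> (u \<in> {x<..<y})"
    then have "emeasure lborel {x<..<y} = 0"
      by (subst (asm) AE_iff_measurable[where N = "{x<..<y}"]) auto
    with assms show False by simp
  qed
  moreover have "AE u in lborel. \<not> (u \<in> {x<..<y})" if "emeasure (beta_distr \<alpha> \<beta>) {x<..y} = 0"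
  proof -
    have "(\<integral>\<^sup>+u. ennreal (beta_density \<alpha> \<beta> u) * indicator {x<..y} u \<partial>lborel) = 0"
      using that by (simp add: beta_distr_def emeasure_density)
    then have "AE u in lborel. ennreal (beta_density \<alpha> \<beta> u) * indicator {x<..y} u = 0"
      by (subst (asm) nn_integral_0_iff_AE) auto
    then show ?thesis
    proof eventually_elim
      case (elim u)
      show ?case
      proof
        assume u: "u \<in> {x<..<y}"
        then have "0 < u" "u < 1" using assms by auto
        then have "beta_density \<alpha> \<beta> u > 0"
          using assms by (auto simp: beta_density_def Beta_def Gamma_real_pos intro!: divide_pos_pos mult_pos_pos)
        with elim u show False by (auto simp: indicator_def)
      qed
    qed
  qed
  ultimately have "emeasure (beta_distr \<alpha> \<beta>) {x<..y} \<noteq> 0" by blast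
  then have "measure (beta_distr \<alpha> \<beta>) {x<..y} > 0"
    by (simp add: emeasure_eq_measure zero_less_measure_iff)
  with cdf_diff_eq[OF assms(4)] show ?thesis by simp
qed

lemma isCont_cdf_beta_distr:
  assumes "\<alpha> > 0" "\<beta> > 0"
  shows "isCont (cdf (beta_distr \<alpha> \<beta>)) x"
proof -
  interpret prob_space "beta_distr \<alpha> \<beta>" using prob_space_beta_distr assms by blast
  interpret finite_borel_measure "beta_distr \<alpha> \<beta>"
    by standard (simp add: beta_distr_def)
  have "AE u in lborel. u \<noteq> x"
    by (rule AE_lborel_singleton)
  then have "AE u in lborel. ennreal (beta_density \<alpha> \<beta> u) * indicator {x} u = 0"
    by eventually_elim auto
  then have "emeasure (beta_distr \<alpha> \<beta>) {x} = 0"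
    unfolding beta_distr_def
    by (subst emeasure_density) (auto simp: nn_integral_0_iff_AE)
  then show ?thesis by (simp add: isCont_cdf measure_def)
qed

lemma cdf_beta_distr_0:
  shows "cdf (beta_distr \<alpha> \<beta>) 0 = 0"
proof -
  have "(\<integral>\<^sup>+u. ennreal (beta_density \<alpha> \<beta> u) * indicator {..0} u \<partial>lborel) = (\<integral>\<^sup>+u. 0 \<partial>(lborel::real measure))"
    by (intro nn_integral_cong) (auto simp: beta_density_def indicator_def)
  then show ?thesis by (simp add: cdf_def measure_def beta_distr_def emeasure_density)
qed

lemma cdf_beta_distr_1:
  assumes "\<alpha> > 0" "\<beta> > 0"
  shows "cdf (beta_distr \<alpha> \<beta>) 1 = 1"
proof -
  interpret prob_space "beta_distr \<alpha> \<beta>" using prob_space_beta_distr assms by blast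
  have "(\<integral>\<^sup>+u. ennreal (beta_density \<alpha> \<beta> u) * indicator {..1} u \<partial>lborel) = (\<integral>\<^sup>+u. ennreal (beta_density \<alpha> \<beta> u) * indicator UNIV u \<partial>lborel)"
    by (intro nn_integral_cong) (auto simp: beta_density_def indicator_def)
  then have "measure (beta_distr \<alpha> \<beta>) {..1} = measure (beta_distr \<alpha> \<beta>) UNIV"
    unfolding measure_def beta_distr_def by (simp add: emeasure_density)
  moreover have "space (beta_distr \<alpha> \<beta>) = UNIV" by (simp add: beta_distr_def)
  ultimately show ?thesis using prob_space by (simp add: cdf_def)
qed

lemma ex1_equipoint:
  assumes "s > 0" "t > 0"
  shows "\<exists>!x. x \<in> {0..1} \<and> reg_inc_beta x s (t + 1) + reg_inc_beta x (s + 1) t = 1"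
proof -
  let ?f = "\<lambda>x. reg_inc_beta x s (t + 1) + reg_inc_beta x (s + 1) t"
  have "\<exists>x. 0 \<le> x \<and> x \<le> 1 \<and> ?f x = 1"
  proof (rule IVT)
    show "\<forall>x. 0 \<le> x \<and> x \<le> 1 \<longrightarrow> isCont ?f x"
      unfolding reg_inc_beta_def using assms
      by (auto intro!: continuous_add isCont_cdf_beta_distr)
  qed (use assms in \<open>auto simp: reg_inc_beta_def cdf_beta_distr_0 cdf_beta_distr_1\<close>)
  moreover have "?f x < ?f y" if "0 \<le> x" "x < y" "y \<le> 1" for x y
    unfolding reg_inc_beta_def using assms that
    by (intro add_strict_mono cdf_beta_distr_strict_mono) auto
  ultimately show ?thesis
    by (metis (no_types, lifting) atLeastAtMost_iff less_irrefl linorder_neqE_linordered_idom)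
qed

end

theory Submission
  imports Defs
begin

text \<open>
  Write \<open>t = d - s\<close>, so that \<open>1 < t \<le> s\<close>. The cumulative distribution functions of the Beta
  distributions with parameters \<open>(s, t)\<close>, \<open>(s, t + 1)\<close>, \<open>(s + 1, t)\<close> differ by multiples of the
  elementary function \<open>K x = x\<^sup>s (1 - x)\<^sup>t / B(s, t)\<close>, which peaks at \<open>s / d\<close>. Put
  \<open>w x = (1/s + 1/t) K x = I\<^sub>x(s, t + 1) - I\<^sub>x(s + 1, t)\<close>, the continuous version of the binomial
  probability of exactly \<open>s\<close> successes in \<open>d\<close> trials.

  For the first claim the Gamma factors cancel: the difference of the two values is
  an integral of a Beta density over an interval of length \<open>1/d\<close> minus \<open>w (s/d)\<close>, and the mean value
  theorem reduces it to the elementary inequality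
  \<open>(1 + u/s)\<^sup>s (1 - u/t)\<^bsup>t-1\<^esup> \<ge> 1\<close> for \<open>0 \<le> u \<le> 1\<close> (\<open>Phi_hat_step\<close>).

  For the second claim, the equation defining the equipoint \<open>e\<close> gives
  \<open>\<Phi>(s) = (1 + w e) / 2\<close>, so two values of \<open>w\<close> have to be compared. At \<open>s\<close> the bound
  \<open>w e \<le> w (s/d)\<close> by the maximum is good enough. At \<open>s + 1\<close> a lower bound is needed, and it follows
  by monotonicity once the new equipoint is enclosed between \<open>(s + 3/2) / (d + 1)\<close> and the peak
  \<open>(s + 1) / d\<close>. What remains is then an explicit inequality between powers (\<open>kernel_step_le\<close>).

  The enclosure (\<open>mean_le_equipoint\<close>, \<open>equipoint_le_mean\<close>) compares the masses on the two sides of a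
  point \<open>c\<close> under a density \<open>a\<close>. The device is a function \<open>Q\<close> with \<open>Q' x = - (x - c) a x\<close>, which for
  Beta densities is elementary: integrating \<open>a = - Q' / (x - c)\<close> by parts turns a pointwise comparison
  of \<open>Q\<close> at two points on either side of \<open>c\<close> into a comparison of masses
  (\<open>bisected_mass_comparison\<close>). For the upper bound the two points have reciprocal distances to \<open>c\<close>
  differing by a constant, and for the lower bound they are mirror images of each other.
\<close>

section \<open>Beta distribution functions with neighbouring parameters\<close>

text \<open>
  With exponents \<open>s\<close>, \<open>t\<close> instead of \<open>s - 1\<close>, \<open>t - 1\<close> the expression vanishes at both endpoints and has
  an elementary derivative. The normalisation is that of the Beta density with parameters \<open>(s, t)\<close>,
  so that the derivative is a linear factor times this density.
\<close>
definition beta_kernel :: "real \<Rightarrow> real \<Rightarrow> real \<Rightarrow> real" where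
  "beta_kernel s t x = x powr s * (1 - x) powr t / Beta s t"

lemma Beta_pos: "Beta s t > 0" if "s > 0" "t > (0::real)"
  using that by (auto simp: Beta_def Gamma_real_pos)

lemma Beta_real_plus1:
  fixes s t :: real
  assumes "s > 0" "t > 0"
  shows "Beta s (t + 1) = t / (s + t) * Beta s t" "Beta (s + 1) t = s / (s + t) * Beta s t"
  using Beta_plus1_right[of t s] Beta_plus1_left[of s t] assms
  by (simp_all add: field_simps nonpos_Ints_def)

lemma integrable_beta_density:
  assumes "\<alpha> > 0" "\<beta> > 0"
  shows "beta_density \<alpha> \<beta> integrable_on {0..1}"
proof -
  have "((\<lambda>x. x powr (\<alpha> - 1) * (1 - x) powr (\<beta> - 1) / Beta \<alpha> \<beta>) has_integral Beta \<alpha> \<beta> / Beta \<alpha> \<beta>) {0..1}"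
    by (intro has_integral_divide has_integral_Beta_real assms)
  then have "(beta_density \<alpha> \<beta> has_integral Beta \<alpha> \<beta> / Beta \<alpha> \<beta>) {0..1}"
    by (rule has_integral_spike_finite[where S = "{0, 1}", rotated 2])
       (auto simp: beta_density_def)
  then show ?thesis by blast
qed

lemma reg_inc_beta_eq_integral:
  assumes "\<alpha> > 0" "\<beta> > 0" "0 \<le> x" "x \<le> 1"
  shows "reg_inc_beta x \<alpha> \<beta> = integral {0..x} (beta_density \<alpha> \<beta>)"
proof -
  let ?f = "beta_density \<alpha> \<beta>" and ?g = "\<lambda>u. indicator {..x} u * beta_density \<alpha> \<beta> u"
  have "?f integrable_on {0..x}"
    using integrable_on_subinterval[OF integrable_beta_density] assms by auto
  then have "(?f has_integral integral {0..x} ?f) {0..x}"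
    by (rule integrable_integral)
  then have "(?g has_integral integral {0..x} ?f) {0..x}"
    by (rule has_integral_eq[rotated]) auto
  then have "(?g has_integral integral {0..x} ?f) UNIV"
    by (rule has_integral_on_superset) (auto simp: beta_density_def indicator_def)
  then have "(\<integral>\<^sup>+u. ennreal (?g u) \<partial>lborel) = ennreal (integral {0..x} ?f)"
    by (intro nn_integral_has_integral_lborel)
       (auto intro!: mult_nonneg_nonneg beta_density_nonneg assms)
  moreover have "(\<integral>\<^sup>+u. ennreal (?g u) \<partial>lborel)
      = (\<integral>\<^sup>+u. ennreal (?f u) * indicator {..x} u \<partial>lborel)"
    by (intro nn_integral_cong) (auto simp: indicator_def)
  moreover have "integral {0..x} ?f \<ge> 0"
    using beta_density_nonneg[OF assms(1,2)] by (intro integral_nonneg) (auto intro: \<open>?f integrable_on {0..x}\<close>)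
  ultimately show ?thesis
    by (simp add: reg_inc_beta_def cdf_def measure_def beta_distr_def emeasure_density)
qed

lemma reg_inc_beta_has_derivative:
  assumes "\<alpha> > 0" "\<beta> > 0" "0 < x" "x < 1"
  shows "((\<lambda>x. reg_inc_beta x \<alpha> \<beta>) has_real_derivative
           beta_density \<alpha> \<beta> x) (at x)"
proof -
  let ?g = "\<lambda>x. x powr (\<alpha> - 1) * (1 - x) powr (\<beta> - 1) / Beta \<alpha> \<beta>"
  have op: "open {0<..<1::real}" by simp
  have x: "x \<in> {0<..<1}" using assms by auto
  have "isCont ?g x"
    using assms Beta_pos[of \<alpha> \<beta>] by (intro continuous_intros) auto
  then have "isCont (beta_density \<alpha> \<beta>) x"
    by (subst isCont_cong[where g = ?g])
       (auto simp: beta_density_def intro!: eventually_nhds_in_open[OF op x, THEN eventually_mono])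
  then have "((\<lambda>u. integral {0..u} (beta_density \<alpha> \<beta>)) has_vector_derivative beta_density \<alpha> \<beta> x)
      (at x within {0..1})"
    using assms
    by (intro integral_has_vector_derivative_continuous_at[where S = "{}", simplified]
          integrable_beta_density)
       (auto intro: continuous_at_imp_continuous_at_within)
  then have "((\<lambda>u. integral {0..u} (beta_density \<alpha> \<beta>)) has_real_derivative beta_density \<alpha> \<beta> x) (at x within {0<..<1})"
    using assms
    by (auto simp: has_real_derivative_iff_has_vector_derivative
        intro: has_vector_derivative_within_subset)
  then have "((\<lambda>u. integral {0..u} (beta_density \<alpha> \<beta>)) has_real_derivative beta_density \<alpha> \<beta> x) (at x)"
    using at_within_open[OF x op] by simp
  then show ?thesis
    by (rule DERIV_cong_ev[THEN iffD1, rotated 3])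
       (use reg_inc_beta_eq_integral[OF assms(1,2)] in
        \<open>auto intro!: eventually_nhds_in_open[OF op x, THEN eventually_mono]\<close>)
qed

lemma reg_inc_beta_ends:
  shows "reg_inc_beta 0 \<alpha> \<beta> = 0" "\<alpha> > 0 \<Longrightarrow> \<beta> > 0 \<Longrightarrow> reg_inc_beta 1 \<alpha> \<beta> = 1"
  by (simp_all add: reg_inc_beta_def cdf_beta_distr_0 cdf_beta_distr_1)

lemma isCont_reg_inc_beta:
  "\<alpha> > 0 \<Longrightarrow> \<beta> > 0 \<Longrightarrow> isCont (\<lambda>x. reg_inc_beta x \<alpha> \<beta>) x"
  using isCont_cdf_beta_distr[of \<alpha> \<beta> x] by (simp add: reg_inc_beta_def[abs_def])

lemma continuous_on_beta_kernel: "s > 0 \<Longrightarrow> t > 0 \<Longrightarrow> continuous_on {0..1} (beta_kernel s t)"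
  unfolding beta_kernel_def[abs_def] using Beta_pos[of s t]
  by (intro continuous_intros continuous_on_powr') auto

lemma beta_kernel_ends: "beta_kernel s t 0 = 0" "beta_kernel s t 1 = 0"
  by (auto simp: beta_kernel_def)

lemma beta_kernel_has_derivative:
  assumes "s > 0" "t > 0" "0 < x" "x < 1"
  shows "(beta_kernel s t has_real_derivative
           (s - (s + t) * x) * beta_density s t x) (at x)"
proof -
  have *: "x powr s = x * x powr (s - 1)" "(1 - x) powr t = (1 - x) * (1 - x) powr (t - 1)"
    using assms by (simp_all add: powr_diff)
  show ?thesis unfolding beta_kernel_def[abs_def]
    by (rule derivative_eq_intros refl | use assms Beta_pos[of s t] in \<open>simp; fail\<close>)+
       (use assms Beta_pos[of s t] in \<open>simp add: beta_density_def field_simps * \<close>)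
qed

text \<open>
  These are the recurrences that arise from integration by parts. Both sides vanish at 0 and have the
  same derivative, so no boundary behaviour of the densities, which may be unbounded, has to be
  studied.
\<close>
lemma reg_inc_beta_shift:
  assumes "s > 0" "t > 0" "0 \<le> x" "x \<le> 1"
  shows "reg_inc_beta x s (t + 1) = reg_inc_beta x s t + beta_kernel s t x / t"
    and "reg_inc_beta x (s + 1) t = reg_inc_beta x s t - beta_kernel s t x / s"
proof -
  have zero: "f x = 0"
    if "continuous_on {0..1} f" "f 0 = 0" "\<And>y. 0 < y \<Longrightarrow> y < 1 \<Longrightarrow> DERIV f y :> 0" for f :: "real \<Rightarrow> real"
  proof (cases "x = 0")
    case False
    with assms have "0 < x" by simp
    moreover from that(1) have "continuous_on {0..x} f"
      by (rule continuous_on_subset) (use assms in auto)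
    ultimately have "f x = f 0"
      by (rule DERIV_isconst_end) (use that(3) assms in auto)
    with that(2) show ?thesis by simp
  qed (use that in auto)
  note B = Beta_pos[OF assms(1,2)]
  note B1 = Beta_real_plus1[OF assms(1,2)]
  have cont: "continuous_on {0..1} (\<lambda>x. reg_inc_beta x a b)" if "a > 0" "b > 0" for a b
    using isCont_reg_inc_beta[OF that] by (auto intro: continuous_at_imp_continuous_on)
  have "reg_inc_beta x s (t + 1) - (reg_inc_beta x s t + beta_kernel s t x / t) = 0"
  proof (rule zero)
    fix y :: real assume y: "0 < y" "y < 1"
    show "((\<lambda>x. reg_inc_beta x s (t + 1) - (reg_inc_beta x s t + beta_kernel s t x / t)) has_real_derivative 0) (at y)"
      by (rule derivative_eq_intros reg_inc_beta_has_derivative beta_kernel_has_derivative refl |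
            use assms y in \<open>simp; fail\<close>)+
         (use assms y B in \<open>simp add: beta_density_def B1 powr_diff divide_simps, simp add: algebra_simps\<close>)
  qed (use assms in \<open>auto intro!: continuous_intros cont continuous_on_beta_kernel simp: reg_inc_beta_ends beta_kernel_ends\<close>)
  then show "reg_inc_beta x s (t + 1) = reg_inc_beta x s t + beta_kernel s t x / t" by simp
  have "reg_inc_beta x (s + 1) t - (reg_inc_beta x s t - beta_kernel s t x / s) = 0"
  proof (rule zero)
    fix y :: real assume y: "0 < y" "y < 1"
    show "((\<lambda>x. reg_inc_beta x (s + 1) t - (reg_inc_beta x s t - beta_kernel s t x / s)) has_real_derivative 0) (at y)"
      by (rule derivative_eq_intros reg_inc_beta_has_derivative beta_kernel_has_derivative refl |
            use assms y in \<open>simp; fail\<close>)+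
         (use assms y B in \<open>simp add: beta_density_def B1 powr_diff divide_simps, simp add: algebra_simps\<close>)
  qed (use assms in \<open>auto intro!: continuous_intros cont continuous_on_beta_kernel simp: reg_inc_beta_ends beta_kernel_ends\<close>)
  then show "reg_inc_beta x (s + 1) t = reg_inc_beta x s t - beta_kernel s t x / s" by simp
qed

lemma beta_kernel_le_iff_log:
  assumes "s > 0" "t > 0" "0 < x" "x < 1" "0 < y" "y < 1"
  shows "beta_kernel s t x \<le> beta_kernel s t y
    \<longleftrightarrow> s * ln x + t * ln (1 - x) \<le> s * ln y + t * ln (1 - y)"
proof -
  have "u powr s * (1 - u) powr t = exp (s * ln u + t * ln (1 - u))" if "0 < u" "u < 1" for u
    using that by (simp add: powr_def exp_add)
  then show ?thesis
    using assms Beta_pos[of s t] by (simp add: beta_kernel_def divide_le_cancel)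
qed

lemma beta_kernel_nonneg: "s > 0 \<Longrightarrow> t > 0 \<Longrightarrow> beta_kernel s t x \<ge> 0"
  using Beta_pos[of s t] by (simp add: beta_kernel_def)

lemma beta_kernel_eq_density:
  assumes "0 < x" "x < 1"
  shows "beta_kernel s t x = x * (1 - x) * beta_density s t x"
  using assms by (simp add: beta_kernel_def beta_density_def powr_diff)

text \<open>
  This is the weighted inequality of the geometric and arithmetic means, in the form \<open>ln u \<le> u - 1\<close>
  applied to the ratios \<open>x / (s / (s + t))\<close> and \<open>(1 - x) / (t / (s + t))\<close>.
\<close>
lemma beta_kernel_le_max:
  assumes "s > 0" "t > 0" "0 \<le> x" "x \<le> 1"
  shows "beta_kernel s t x \<le> beta_kernel s t (s / (s + t))"
proof (cases "x = 0 \<or> x = 1")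
  case True
  then show ?thesis using beta_kernel_nonneg assms by (auto simp: beta_kernel_ends)
next
  case False
  with assms have x: "0 < x" "x < 1" by auto
  have c: "1 - s / (s + t) = t / (s + t)" using assms by (simp add: field_simps)
  have ln_quot: "ln (x / (s / (s + t))) = ln x - ln (s / (s + t))"
    "ln ((1 - x) / (t / (s + t))) = ln (1 - x) - ln (t / (s + t))"
    using x assms by (subst ln_div; simp)+
  have "s * ln (x / (s / (s + t))) \<le> s * (x / (s / (s + t)) - 1)"
    using x assms by (intro mult_left_mono ln_le_minus_one) auto
  moreover have "t * ln ((1 - x) / (t / (s + t))) \<le> t * ((1 - x) / (t / (s + t)) - 1)"
    using x assms by (intro mult_left_mono ln_le_minus_one) auto
  moreover have "s * (x / (s / (s + t)) - 1) + t * ((1 - x) / (t / (s + t)) - 1) = 0"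
    using assms by (simp add: field_simps)
  ultimately have "s * ln x + t * ln (1 - x) \<le> s * ln (s / (s + t)) + t * ln (t / (s + t))"
    unfolding ln_quot right_diff_distrib by linarith
  then show ?thesis
    using x assms by (subst beta_kernel_le_iff_log) (auto simp: c)
qed

lemma beta_kernel_mono_below_max:
  assumes "s > 0" "t > 0" "0 < x" "x \<le> y" "y \<le> s / (s + t)"
  shows "beta_kernel s t x \<le> beta_kernel s t y"
proof (rule DERIV_nonneg_imp_nondecreasing[OF assms(4)])
  fix w assume w: "x \<le> w" "w \<le> y"
  with assms have "w \<le> s / (s + t)" by linarith
  moreover have "s / (s + t) < 1" using assms by simp
  ultimately have "0 < w" "w < 1" "(s + t) * w \<le> s"
    using assms w by (linarith, linarith, simp add: field_simps)
  then show "\<exists>y. (beta_kernel s t has_real_derivative y) (at w) \<and> 0 \<le> y"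
    using assms
    by (intro exI[of _ "(s - (s + t) * w) * beta_density s t w"] conjI
        beta_kernel_has_derivative mult_nonneg_nonneg beta_density_nonneg) auto
qed

section \<open>The step inequality at the mean\<close>

text \<open>
  The logarithm of the fact that \<open>(1 + u/t)\<^sup>t\<close> increases with the real exponent \<open>t\<close>.
\<close>
lemma mult_ln_one_plus_mono:
  fixes s t u :: real
  assumes "0 < t" "t \<le> s" "0 \<le> u"
  shows "t * ln (1 + u / t) \<le> s * ln (1 + u / s)"
proof (rule DERIV_nonneg_imp_nondecreasing[OF assms(2)])
  fix w assume w: "t \<le> w" "w \<le> s"
  with assms have w0: "w > 0" by simp
  have pos: "0 < 1 + u / w" using w0 assms by (simp add: add_pos_nonneg)
  have "((\<lambda>w. w * ln (1 + u / w)) has_real_derivative ln (1 + u / w) - (u / w) / (1 + u / w)) (at w)"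
  proof -
    have "w * (- (u / w\<^sup>2) / (1 + u / w)) = - ((u / w) / (1 + u / w))"
      using w0 by (simp add: power2_eq_square)
    then show ?thesis
      using w0 pos by (auto intro!: derivative_eq_intros simp: power2_eq_square)
  qed
  moreover have "ln (1 + u / w) \<ge> (u / w) / (1 + u / w)"
  proof -
    have "ln (1 / (1 + u / w)) \<le> 1 / (1 + u / w) - 1"
      using pos by (intro ln_le_minus_one) auto
    moreover have "1 / (1 + z) - 1 = - (z / (1 + z))" if "1 + z > 0" for z :: real
      using that by (simp add: field_simps)
    ultimately show ?thesis using pos by (simp add: ln_div del: divide_divide_eq_left divide_divide_eq_right)
  qed
  ultimately show "\<exists>y. ((\<lambda>w. w * ln (1 + u / w)) has_real_derivative y) (at w) \<and> 0 \<le> y"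
    by (intro exI conjI) auto
qed

text \<open>
  Rewriting both values through the parameters \<open>(s + 1, t)\<close> leaves an increment of one distribution
  function over an interval of length \<open>1/d\<close>. At a point \<open>z = (s + u) / d\<close> of this interval the density,
  relative to the term to be beaten, is \<open>(1 + u/s)\<^sup>s (1 - u/t)\<^bsup>t-1\<^esup>\<close>. It is at least 1 because
  \<open>1 / (1 - u/t) = 1 + u / (t - u)\<close> and \<open>t - 1 \<le> t - u \<le> s\<close>.
\<close>
lemma Phi_hat_step:
  assumes "1 < t" "t \<le> s"
  shows "reg_inc_beta (s / (s + t)) s (t + 1) \<le> reg_inc_beta ((s + 1) / (s + t)) (s + 1) t"
proof -
  define d where "d = s + t"
  have d: "d > 0" "s > 0" using assms by (auto simp: d_def)
  have "\<exists>z>s / d. z < (s + 1) / d \<and>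
    reg_inc_beta ((s + 1) / d) (s + 1) t - reg_inc_beta (s / d) (s + 1) t
      = ((s + 1) / d - s / d) * beta_density (s + 1) t z"
    using assms d
    by (intro MVT2 reg_inc_beta_has_derivative)
       (auto simp: divide_less_cancel pos_divide_le_eq pos_le_divide_eq d_def field_simps
        intro: less_le_trans[OF divide_pos_pos[of s "s + t"]] le_less_trans[of _ "(s + 1) / (s + t)"])
  then obtain z where z: "s / d < z" "z < (s + 1) / d"
    and mvt: "reg_inc_beta ((s + 1) / d) (s + 1) t - reg_inc_beta (s / d) (s + 1) t
      = ((s + 1) / d - s / d) * beta_density (s + 1) t z" by blast
  define u where "u = z * d - s"
  have u: "0 < u" "u < 1" using z d by (auto simp: u_def field_simps)
  have zu: "z = s / d * (1 + u / s)" "1 - z = t / d * (1 - u / t)"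
  proof -
    have "s + u = z * d" "t - u = (1 - z) * d" by (simp_all add: u_def d_def algebra_simps)
    moreover have "1 + u / s = (s + u) / s" "1 - u / t = (t - u) / t"
      using d assms by (simp_all add: field_simps)
    ultimately show "z = s / d * (1 + u / s)" "1 - z = t / d * (1 - u / t)"
      using d assms by simp_all
  qed
  have z01: "0 < z" "z < 1"
  proof -
    show "0 < z" using z d by (auto intro: less_trans[of 0 "s / d"])
    have "(s + 1) / d < 1" using assms d by (simp add: d_def)
    with z show "z < 1" by linarith
  qed
  have ut: "u < t" "0 < t" using u assms by auto
  \<comment> \<open>Here \<open>u \<le> 1\<close> enlarges the exponent to \<open>t - u\<close>, which matches the increment \<open>u / (t - u)\<close>.\<close>
  have "(t - 1) * ln (1 + u / (t - u)) \<le> (t - u) * ln (1 + u / (t - u))"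
    using u ut by (intro mult_right_mono) auto
  also have "\<dots> \<le> s * ln (1 + u / s)"
    using u ut assms by (intro mult_ln_one_plus_mono) auto
  also have "ln (1 + u / (t - u)) = - ln (1 - u / t)"
  proof -
    have "1 + u / (t - u) = inverse (1 - u / t)" using ut by (simp add: field_simps)
    then show ?thesis using ut by (simp add: ln_inverse)
  qed
  finally have key: "0 \<le> s * ln (1 + u / s) + (t - 1) * ln (1 - u / t)" by simp
  have pos: "0 < 1 + u / s" "0 < 1 - u / t" using u ut d by (auto simp: add_pos_pos)
  have "1 \<le> (1 + u / s) powr s * (1 - u / t) powr (t - 1)"
    using key pos ut by (simp add: powr_def flip: exp_add)
  then have "(s / d) powr s * (t / d) powr (t - 1) * 1
      \<le> (s / d) powr s * (t / d) powr (t - 1) * ((1 + u / s) powr s * (1 - u / t) powr (t - 1))"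
    by (intro mult_left_mono) auto
  also have "\<dots> = z powr s * (1 - z) powr (t - 1)"
    by (subst zu(2), subst zu(1)) (use pos d ut in \<open>simp add: powr_mult powr_divide\<close>)
  finally have ge: "(s / d) powr s * (t / d) powr (t - 1) \<le> z powr s * (1 - z) powr (t - 1)" by simp
  have B: "Beta (s + 1) t = s / d * Beta s t"
    using Beta_real_plus1(2)[of s t] d ut by (simp add: d_def)
  have Bp: "Beta s t > 0" using Beta_pos d ut by auto
  have c: "1 - s / d = t / d" using d by (simp add: d_def field_simps)
  have "beta_kernel s t (s / d) / t + beta_kernel s t (s / d) / s
      = (s / d) powr s * (t / d) powr (t - 1) / (s * Beta s t)"
  proof -
    have "(t / d) powr t = t / d * (t / d) powr (t - 1)"
      using ut d by (simp add: powr_diff)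
    moreover have "1 / t + 1 / s = d / (s * t)" using d ut by (simp add: d_def field_simps)
    moreover have "beta_kernel s t (s / d) / t + beta_kernel s t (s / d) / s
       = beta_kernel s t (s / d) * (1 / t + 1 / s)" by (simp add: distrib_left)
    ultimately show ?thesis using d ut Bp by (simp add: beta_kernel_def c)
  qed
  also have "\<dots> \<le> z powr s * (1 - z) powr (t - 1) / (s * Beta s t)"
    using ge d Bp by (intro divide_right_mono) auto
  also have "\<dots> = ((s + 1) / d - s / d) * beta_density (s + 1) t z"
  proof -
    have "(s + 1) / d - s / d = 1 / d" by (simp add: diff_divide_distrib[symmetric])
    then show ?thesis using z01 d Bp by (simp add: beta_density_def B)
  qed
  finally have "beta_kernel s t (s / d) / t + beta_kernel s t (s / d) / s
      \<le> reg_inc_beta ((s + 1) / d) (s + 1) t - reg_inc_beta (s / d) (s + 1) t"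
    unfolding mvt .
  moreover have "0 \<le> s / d" "s / d \<le> 1" using d ut by (auto simp: d_def)
  ultimately show ?thesis
    using reg_inc_beta_shift[of s t "s / d"] d ut by (simp add: d_def)
qed

section \<open>The equation defining the equipoint\<close>

text \<open>
  Half of this function is the distribution function of the equal mixture of the two Beta
  distributions, whose median is therefore the equipoint.
\<close>
definition equipoint_cdf :: "real \<Rightarrow> real \<Rightarrow> real \<Rightarrow> real" where
  "equipoint_cdf s t x = reg_inc_beta x s (t + 1) + reg_inc_beta x (s + 1) t"

lemma equipoint:
  assumes "s > 0" "t > 0"
  shows "0 \<le> equipoint s t" "equipoint s t \<le> 1" "equipoint_cdf s t (equipoint s t) = 1"
  using theI'[OF ex1_equipoint[OF assms]] by (auto simp: equipoint_def equipoint_cdf_def)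

lemma equipoint_cdf_strict_mono:
  assumes "s > 0" "t > 0" "0 \<le> x" "x < y" "y \<le> 1"
  shows "equipoint_cdf s t x < equipoint_cdf s t y"
  unfolding equipoint_cdf_def reg_inc_beta_def using assms
  by (intro add_strict_mono cdf_beta_distr_strict_mono) auto

lemma equipoint_le:
  assumes "s > 0" "t > 0" "0 \<le> x" "1 \<le> equipoint_cdf s t x"
  shows "equipoint s t \<le> x"
  using equipoint[OF assms(1,2)] equipoint_cdf_strict_mono[of s t x "equipoint s t"] assms by force

lemma equipoint_ge:
  assumes "s > 0" "t > 0" "x \<le> 1" "equipoint_cdf s t x \<le> 1"
  shows "x \<le> equipoint s t"
  using equipoint[OF assms(1,2)] equipoint_cdf_strict_mono[of s t "equipoint s t" x] assms by force

lemma equipoint_cdf_eq: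
  assumes "s > 0" "t > 0" "0 \<le> x" "x \<le> 1"
  shows "equipoint_cdf s t x = 2 * reg_inc_beta x s t + (1 / t - 1 / s) * beta_kernel s t x"
  unfolding equipoint_cdf_def reg_inc_beta_shift[OF assms] by (simp add: left_diff_distrib)

text \<open>
  The two summands of the defining equation have sum 1 and their difference is a multiple of the kernel,
  so each of them is determined by the kernel at the equipoint.
\<close>
lemma Phi_eq:
  assumes "s > 0" "t > 0"
  shows "Phi (s + t) s = 1 / 2 + (1 / s + 1 / t) * beta_kernel s t (equipoint s t) / 2"
  using equipoint[OF assms] reg_inc_beta_shift[OF assms, of "equipoint s t"]
  by (simp add: Phi_def equipoint_cdf_def field_simps)

section \<open>Comparing the masses on both sides of a point\<close>

text \<open>
  The density \<open>a\<close> is recovered from \<open>Q\<close> as \<open>- Q' / (x - c)\<close>, so its mass to the right of \<open>c\<close> up to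
  \<open>x r\<close> is obtained by parts from \<open>Q c - Q\<close> with weight \<open>1 / (x - c)\<close>, and likewise on the left. The
  points \<open>x r\<close> and \<open>y r\<close> are chosen so that these weights are \<open>1/r + \<kappa>\<close> and \<open>1/r + \<eta>\<close>. Since they differ by a
  constant, the remaining integrals on both sides run over the same variable with the same measure, and
  their difference has the sign of \<open>Q (x r) - Q (y r)\<close>. In terms of the discrepancy \<open>E\<close> of the two sides
  this says that \<open>E' = (Q (y r) - Q (x r)) / r\<^sup>2\<close> while \<open>E\<close> tends to 0 at 0.
\<close>
lemma bisected_mass_comparison:
  fixes A Q a :: "real \<Rightarrow> real" and c l u \<kappa> \<eta> r :: real
  defines "x \<equiv> \<lambda>\<rho>. c + \<rho> / (1 + \<kappa> * \<rho>)" and "y \<equiv> \<lambda>\<rho>. c - \<rho> / (1 + \<eta> * \<rho>)"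
  assumes A: "\<And>z. l < z \<Longrightarrow> z < u \<Longrightarrow> (A has_real_derivative a z) (at z)"
    and Q: "\<And>z. l < z \<Longrightarrow> z < u \<Longrightarrow> (Q has_real_derivative - (z - c) * a z) (at z)"
    and nn: "\<kappa> \<ge> 0" "\<eta> \<ge> 0" and r: "0 < r"
    and dom: "\<And>\<rho>. 0 < \<rho> \<Longrightarrow> \<rho> \<le> r \<Longrightarrow> l < y \<rho> \<and> x \<rho> < u"
    and le: "\<And>\<rho>. 0 < \<rho> \<Longrightarrow> \<rho> \<le> r \<Longrightarrow> Q (y \<rho>) \<le> Q (x \<rho>)"
  shows "A (x r) + A (y r) - 2 * A c \<le> (Q c - Q (x r)) * (1 / r + \<kappa>) - (Q c - Q (y r)) * (1 / r + \<eta>)"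
proof -
  define E where "E = (\<lambda>\<rho>. A (x \<rho>) + A (y \<rho>) - 2 * A c
      - (Q c - Q (x \<rho>)) * (1 / \<rho> + \<kappa>) + (Q c - Q (y \<rho>)) * (1 / \<rho> + \<eta>))"
  have pos: "1 + \<kappa> * \<rho> > 0" "1 + \<eta> * \<rho> > 0" if "\<rho> \<ge> 0" for \<rho>
    using nn that by (simp_all add: add_pos_nonneg)
  have dx: "(x has_real_derivative 1 / (1 + \<kappa> * \<rho>)\<^sup>2) (at \<rho>)" if "\<rho> \<ge> 0" for \<rho>
    unfolding x_def using pos[OF that]
    by (auto intro!: derivative_eq_intros simp: power2_eq_square field_simps)
  have dy: "(y has_real_derivative - 1 / (1 + \<eta> * \<rho>)\<^sup>2) (at \<rho>)" if "\<rho> \<ge> 0" for \<rho>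
    unfolding y_def using pos[OF that]
    by (auto intro!: derivative_eq_intros simp: power2_eq_square field_simps)
  have xc: "x \<rho> > c" "y \<rho> < c" if "\<rho> > 0" for \<rho>
    using pos[of \<rho>] that by (simp_all add: x_def y_def)
  have c: "l < c" "c < u"
    using dom[of r] xc[of r] r by auto
  have x0: "x 0 = c" "y 0 = c" by (simp_all add: x_def y_def)
  have E': "(E has_real_derivative (Q (y \<rho>) - Q (x \<rho>)) / \<rho>\<^sup>2) (at \<rho>)" if \<rho>: "0 < \<rho>" "\<rho> \<le> r" for \<rho>
  proof -
    have in_dom: "l < x \<rho>" "x \<rho> < u" "l < y \<rho>" "y \<rho> < u"
      using dom[OF \<rho>] xc[OF \<rho>(1)] c by auto
    have 1: "((\<lambda>\<rho>. A (x \<rho>)) has_real_derivative a (x \<rho>) * (1 / (1 + \<kappa> * \<rho>)\<^sup>2)) (at \<rho>)"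
      "((\<lambda>\<rho>. A (y \<rho>)) has_real_derivative a (y \<rho>) * (- 1 / (1 + \<eta> * \<rho>)\<^sup>2)) (at \<rho>)"
      "((\<lambda>\<rho>. Q (x \<rho>)) has_real_derivative - (x \<rho> - c) * a (x \<rho>) * (1 / (1 + \<kappa> * \<rho>)\<^sup>2)) (at \<rho>)"
      "((\<lambda>\<rho>. Q (y \<rho>)) has_real_derivative - (y \<rho> - c) * a (y \<rho>) * (- 1 / (1 + \<eta> * \<rho>)\<^sup>2)) (at \<rho>)"
      using in_dom \<rho>
      by (intro DERIV_chain2[OF A dx] DERIV_chain2[OF A dy]
          DERIV_chain2[OF Q dx] DERIV_chain2[OF Q dy]; simp)+
    have 2: "(x \<rho> - c) * (1 / \<rho> + \<kappa>) = 1" "(y \<rho> - c) * (1 / \<rho> + \<eta>) = - 1"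
    proof -
      have "1 / \<rho> + k = (1 + k * \<rho>) / \<rho>" for k
        using \<rho> by (simp add: field_simps)
      then show "(x \<rho> - c) * (1 / \<rho> + \<kappa>) = 1" "(y \<rho> - c) * (1 / \<rho> + \<eta>) = - 1"
        using pos[of \<rho>] \<rho> by (simp_all add: x_def y_def)
    qed
    have 3: "((\<lambda>\<rho>. 1 / \<rho> + k) has_real_derivative - 1 / \<rho>\<^sup>2) (at \<rho>)" for k
      using \<rho> by (auto intro!: derivative_eq_intros simp: power2_eq_square)
    define p q where "p = a (x \<rho>) * (1 / (1 + \<kappa> * \<rho>)\<^sup>2)" and "q = a (y \<rho>) * (- 1 / (1 + \<eta> * \<rho>)\<^sup>2)"
    have "(E has_real_derivative p + q - 0
        - ((0 - (- (x \<rho> - c) * p)) * (1 / \<rho> + \<kappa>) + (- 1 / \<rho>\<^sup>2) * (Q c - Q (x \<rho>)))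
        + ((0 - (- (y \<rho> - c) * q)) * (1 / \<rho> + \<eta>) + (- 1 / \<rho>\<^sup>2) * (Q c - Q (y \<rho>)))) (at \<rho>)"
      unfolding E_def p_def q_def
      using 1 by (intro DERIV_add DERIV_diff DERIV_mult 3 DERIV_const) (simp_all add: mult.assoc)
    moreover have "p + q - 0
        - ((0 - (- (x \<rho> - c) * p)) * (1 / \<rho> + \<kappa>) + (- 1 / \<rho>\<^sup>2) * (Q c - Q (x \<rho>)))
        + ((0 - (- (y \<rho> - c) * q)) * (1 / \<rho> + \<eta>) + (- 1 / \<rho>\<^sup>2) * (Q c - Q (y \<rho>)))
      = p + q - p * ((x \<rho> - c) * (1 / \<rho> + \<kappa>)) + q * ((y \<rho> - c) * (1 / \<rho> + \<eta>))
        + (Q (y \<rho>) - Q (x \<rho>)) / \<rho>\<^sup>2"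
      by (simp add: algebra_simps diff_divide_distrib)
    ultimately show ?thesis unfolding 2 by simp
  qed
  have decr: "E r \<le> E \<rho>" if "0 < \<rho>" "\<rho> < r" for \<rho>
  proof (rule DERIV_nonpos_imp_nonincreasing[OF less_imp_le[OF that(2)]])
    fix w assume "\<rho> \<le> w" "w \<le> r"
    then show "\<exists>z. DERIV E w :> z \<and> z \<le> 0"
      using E'[of w] le[of w] that by (intro exI[of _ "(Q (y w) - Q (x w)) / w\<^sup>2"])
        (auto intro!: divide_nonpos_nonneg)
  qed
  \<comment> \<open>The quotients \<open>(Q c - Q (x r)) / r\<close> vanish in the limit because \<open>Q\<close> is stationary at \<open>c\<close>.\<close>
  have lim: "(E \<longlongrightarrow> 0) (at_right 0)"
  proof -
    have dQ: "((\<lambda>\<rho>. (Q c - Q (g \<rho>)) / \<rho>) \<longlongrightarrow> 0) (at_right 0)"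
      if "(g has_real_derivative D) (at 0)" "g 0 = c" for g D
    proof -
      have "((\<lambda>\<rho>. Q (g \<rho>)) has_real_derivative - (g 0 - c) * a (g 0) * D) (at 0)"
        using c by (intro DERIV_chain2[OF Q that(1)]) (auto simp: that(2))
      then have "(\<lambda>h. (Q (g h) - Q c) / h) \<midarrow>0\<rightarrow> 0"
        by (simp add: DERIV_def that(2))
      then have "((\<lambda>h. - ((Q (g h) - Q c) / h)) \<longlongrightarrow> - 0) (at_right 0)"
        by (intro tendsto_minus) (simp add: filterlim_at_split)
      then show ?thesis by (simp add: minus_divide_left)
    qed
    have cont: "((\<lambda>\<rho>. f (g \<rho>)) \<longlongrightarrow> f c) (at_right 0)"
      if "(g has_real_derivative D) (at 0)" "g 0 = c" "isCont f c" for f g :: "real \<Rightarrow> real" and D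
    proof -
      have "isCont (\<lambda>\<rho>. f (g \<rho>)) 0"
        using that by (intro continuous_within_compose3[of g 0 f, simplified]) (auto dest: DERIV_isCont)
      then show ?thesis using that(2) by (simp add: isCont_def filterlim_at_split)
    qed
    have iA: "isCont A c" and iQ: "isCont Q c"
      using A[OF c] Q[OF c] by (auto dest: DERIV_isCont)
    have "((\<lambda>\<rho>. A (x \<rho>) + A (y \<rho>) - 2 * A c
      - ((Q c - Q (x \<rho>)) / \<rho> + (Q c - Q (x \<rho>)) * \<kappa>) + ((Q c - Q (y \<rho>)) / \<rho> + (Q c - Q (y \<rho>)) * \<eta>))
      \<longlongrightarrow> A c + A c - 2 * A c - (0 + (Q c - Q c) * \<kappa>) + (0 + (Q c - Q c) * \<eta>)) (at_right 0)"
      by (intro tendsto_intros dQ[OF dx] dQ[OF dy] cont[OF dx _ iA] cont[OF dy _ iA]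
          cont[OF dx _ iQ] cont[OF dy _ iQ]) (auto simp: x0)
    then show ?thesis by (simp add: E_def distrib_left)
  qed
  have "E r \<le> 0"
    by (rule tendsto_lowerbound[OF lim])
       (use r decr in \<open>auto simp: eventually_at_right intro!: exI[of _ r]\<close>)
  then show ?thesis by (simp add: E_def)
qed

section \<open>The equipoint lies below the peak\<close>

lemma tendsto_const_over_linear:
  fixes a b k :: real assumes "a > 0"
  shows "((\<lambda>r. k / (a * r + b)) \<longlongrightarrow> 0) at_top"
proof -
  have "filterlim (\<lambda>r. b + a * r) at_top at_top"
    using assms
    by (intro filterlim_tendsto_add_at_top[OF tendsto_const]
        filterlim_tendsto_pos_mult_at_top[OF tendsto_const] filterlim_ident)
  then show ?thesis
    by (intro tendsto_divide_0[OF tendsto_const] filterlim_at_top_imp_at_infinity)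
       (simp add: add.commute)
qed

text \<open>
  With \<open>d = s + t\<close>, the two arguments lie on either side of \<open>s / d\<close>, at distances \<open>\<delta>\<close> on the left and
  \<open>\<epsilon>\<close> on the right with \<open>1/\<epsilon> - d/t = 1/\<delta> - d/s = d/r\<close>. As \<open>r\<close> grows, they
  tend to 0 and 1. The logarithm \<open>H\<close> of the quotient of the two kernel values vanishes at
  \<open>r = 0\<close>, and its derivative is nonnegative because
  \<open>(r + s) (r + t)\<close> exceeds \<open>r (s + t) + s t\<close> by \<open>r\<^sup>2\<close>.
\<close>
lemma beta_kernel_reflection_le:
  assumes "0 < t" "t \<le> s" "0 < r"
  defines "k \<equiv> r * (s + t) + s * t"
  shows "beta_kernel s t (s\<^sup>2 / ((s + t) * (r + s))) \<le> beta_kernel s t (k / ((s + t) * (r + t)))"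
proof -
  define H where "H = (\<lambda>r. (s - t) * ln (r * (s + t) + s * t) + (s + t) * (ln (r + s) - ln (r + t))
      - 2 * s * ln s + 2 * t * ln t)"
  have s: "s > 0" using assms by simp
  have "H 0 \<le> H r"
  proof (rule DERIV_nonneg_imp_nondecreasing[OF less_imp_le[OF \<open>0 < r\<close>]])
    fix w assume w: "0 \<le> w" "w \<le> r"
    have pos: "0 < w * (s + t) + s * t" "0 < w + s" "0 < w + t"
      using w s assms by (auto intro!: add_nonneg_pos)
    have "(H has_real_derivative (s - t) * ((s + t) / (w * (s + t) + s * t))
        + (s + t) * (1 / (w + s) - 1 / (w + t))) (at w)"
      unfolding H_def using pos by (auto intro!: derivative_eq_intros)
    moreover have "1 / (w + s) - 1 / (w + t) = - ((s - t) / ((w + s) * (w + t)))"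
      unfolding minus_divide_left minus_diff_eq using pos by (simp add: field_simps)
    then have "(s + t) * (1 / (w + s) - 1 / (w + t)) = - ((s - t) * ((s + t) / ((w + s) * (w + t))))"
      by (simp add: mult.commute)
    moreover have "(s + t) / ((w + s) * (w + t)) \<le> (s + t) / (w * (s + t) + s * t)"
      using pos s assms by (intro divide_left_mono mult_pos_pos) (auto simp: algebra_simps)
    then have "(s - t) * ((s + t) / ((w + s) * (w + t))) \<le> (s - t) * ((s + t) / (w * (s + t) + s * t))"
      using assms by (intro mult_left_mono) auto
    ultimately show "\<exists>y. (H has_real_derivative y) (at w) \<and> 0 \<le> y"
      by (intro exI conjI) (assumption, simp)
  qed
  moreover have "H 0 = 0"
    using s assms by (simp add: H_def ln_mult algebra_simps)
  ultimately have H: "0 \<le> H r" by simp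
  have k: "k > 0" using s assms by (auto simp: k_def intro!: add_pos_pos)
  have lt: "s\<^sup>2 < (s + t) * (r + s)" "k < (s + t) * (r + t)"
    using s assms by (simp_all add: k_def algebra_simps power2_eq_square add_pos_pos)
  have c: "1 - s\<^sup>2 / ((s + t) * (r + s)) = k / ((s + t) * (r + s))"
    "1 - k / ((s + t) * (r + t)) = t\<^sup>2 / ((s + t) * (r + t))"
    using s assms by (simp_all add: k_def divide_simps power2_eq_square) (simp_all add: algebra_simps)
  have sum: "0 < s + t" "0 < r + s" "0 < r + t" using s assms(1-3) by auto
  have logs: "ln (s\<^sup>2 / ((s + t) * (r + s))) = 2 * ln s - (ln (s + t) + ln (r + s))"
    "ln (t\<^sup>2 / ((s + t) * (r + t))) = 2 * ln t - (ln (s + t) + ln (r + t))"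
    "ln (k / ((s + t) * (r + s))) = ln k - (ln (s + t) + ln (r + s))"
    "ln (k / ((s + t) * (r + t))) = ln k - (ln (s + t) + ln (r + t))"
    using s assms(1) k sum by (simp_all add: ln_div ln_mult ln_realpow)
  have "s * ln (s\<^sup>2 / ((s + t) * (r + s))) + t * ln (1 - s\<^sup>2 / ((s + t) * (r + s)))
    \<le> s * ln (k / ((s + t) * (r + t))) + t * ln (1 - k / ((s + t) * (r + t)))"
    unfolding c logs using H unfolding H_def k_def[symmetric] by (simp add: algebra_simps)
  then show ?thesis
    using s k lt sum assms(1) by (subst beta_kernel_le_iff_log) auto
qed

text \<open>
  A version of Simmons' inequality for binomial tails with real parameters. For the density with
  parameters \<open>(s, t)\<close> and \<open>c = s / d\<close> the function \<open>Q\<close> is \<open>K / d\<close>. Letting \<open>r\<close> grow, the points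
  \<open>x r\<close>, \<open>y r\<close> exhaust the unit interval, the kernel values at the ends vanish, and only \<open>K c / d\<close> times the
  difference \<open>d/t - d/s\<close> of the two weights survives. This is exactly the correction between
  \<open>2 I\<^sub>c(s, t)\<close> and the sum that defines the equipoint.
\<close>
lemma equipoint_le_mean:
  assumes "0 < t" "t \<le> s"
  shows "equipoint s t \<le> s / (s + t)"
proof (rule equipoint_le)
  define d c where "d = s + t" and "c = s / d"
  define J K where "J = (\<lambda>x. reg_inc_beta x s t)" and "K = beta_kernel s t"
  define x y where "x = (\<lambda>r. c + r / (1 + d / t * r))" and "y = (\<lambda>r. c - r / (1 + d / s * r))"
  have pos: "0 < s" "0 < t" "0 < d" using assms by (auto simp: d_def)
  have x: "x r = (d * r * d + s * t) / (d * (d * r + t))" "x r = 1 - t\<^sup>2 / d / (d * r + t)"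
    and y: "y r = s\<^sup>2 / (d * (d * r + s))" "y r = s\<^sup>2 / d / (d * r + s)" if "0 < r" for r
  proof -
    have p: "0 < d * r + t" "0 < d * r + s" using that pos by (auto intro: add_pos_pos)
    have "1 + d / t * r = (d * r + t) / t" "1 + d / s * r = (d * r + s) / s"
      using pos by (simp_all add: field_simps)
    then have "x r = s / d + r * t / (d * r + t)" "y r = s / d - r * s / (d * r + s)"
      by (simp_all add: x_def y_def c_def)
    moreover have "d * (d * r) = d * (r * s) + d * (r * t)" by (simp add: d_def algebra_simps)
    ultimately show "x r = (d * r * d + s * t) / (d * (d * r + t))" "y r = s\<^sup>2 / (d * (d * r + s))"
      "y r = s\<^sup>2 / d / (d * r + s)"
      using p pos by (simp_all add: divide_simps power2_eq_square) (simp_all add: algebra_simps)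
    moreover have "d * r * d + s * t = d * (d * r + t) - t\<^sup>2"
      by (simp add: d_def algebra_simps power2_eq_square)
    ultimately show "x r = 1 - t\<^sup>2 / d / (d * r + t)"
      using p pos by (simp add: diff_divide_distrib)
  qed
  have xy: "0 < y r" "y r \<le> 1" "0 \<le> x r" "x r < 1" if "0 < r" for r
  proof -
    have p: "0 < d * r + t" "0 < d * r + s" using that pos by (auto intro: add_pos_pos)
    show "0 < y r" "x r < 1" using p pos x(2)[OF that] y(1)[OF that] by simp_all
    have "0 \<le> r / (1 + d / t * r)" "0 \<le> r / (1 + d / s * r)" using pos that
      by (auto intro!: divide_nonneg_nonneg add_nonneg_nonneg)
    moreover have "0 \<le> c" "c \<le> 1" using pos by (auto simp: c_def d_def)
    ultimately show "y r \<le> 1" "0 \<le> x r" by (auto simp: x_def y_def)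
  qed
  have step: "J (x r) + J (y r) - 2 * J c
      \<le> (K c / d - K (x r) / d) * (1 / r + d / t) - (K c / d - K (y r) / d) * (1 / r + d / s)" if "0 < r" for r
    unfolding x_def y_def
  proof (rule bisected_mass_comparison[where a = "beta_density s t" and l = 0 and u = 1])
    fix z :: real assume z: "0 < z" "z < 1"
    show "(J has_real_derivative beta_density s t z) (at z)"
      unfolding J_def using reg_inc_beta_has_derivative z pos by blast
    have "((\<lambda>x. K x / d) has_real_derivative (s - (s + t) * z) * beta_density s t z / d) (at z)"
      unfolding K_def using z pos by (intro DERIV_cdivide beta_kernel_has_derivative) auto
    moreover have "(s - (s + t) * z) * beta_density s t z / d = - (z - c) * beta_density s t z"
      using pos by (simp add: c_def d_def field_simps)
    ultimately show "((\<lambda>x. K x / d) has_real_derivative - (z - c) * beta_density s t z) (at z)" by simp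
  next
    fix \<rho> :: real assume "0 < \<rho>"
    then show "0 < c - \<rho> / (1 + d / s * \<rho>) \<and> c + \<rho> / (1 + d / t * \<rho>) < 1"
      using xy[of \<rho>] by (simp add: x_def y_def)
    have "K (y \<rho>) \<le> K (x \<rho>)"
      unfolding x(1)[OF \<open>0 < \<rho>\<close>] y(1)[OF \<open>0 < \<rho>\<close>] K_def
      using beta_kernel_reflection_le[OF assms, of "d * \<rho>"] pos \<open>0 < \<rho>\<close> by (simp add: d_def)
    then show "K (c - \<rho> / (1 + d / s * \<rho>)) / d \<le> K (c + \<rho> / (1 + d / t * \<rho>)) / d"
      using pos by (simp add: x_def y_def divide_right_mono)
  qed (use that pos in auto)
  have lx: "(x \<longlongrightarrow> 1 - 0) at_top"
    by (rule Lim_transform_eventually[OF tendsto_diff[OF tendsto_const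
          tendsto_const_over_linear[of d "t\<^sup>2 / d" t]]])
       (use x(2) pos in \<open>auto intro: eventually_mono[OF eventually_gt_at_top[of 0]]\<close>)
  have ly: "(y \<longlongrightarrow> 0) at_top"
    by (rule Lim_transform_eventually[OF tendsto_const_over_linear[of d "s\<^sup>2 / d" s]])
       (use y(2) pos in \<open>auto intro: eventually_mono[OF eventually_gt_at_top[of 0]]\<close>)
  have contK: "continuous_on {0..1} K" and contJ: "isCont J z" for z
    unfolding K_def J_def using continuous_on_beta_kernel isCont_reg_inc_beta pos by auto
  have lK: "((\<lambda>r. K (x r)) \<longlongrightarrow> K 1) at_top" "((\<lambda>r. K (y r)) \<longlongrightarrow> K 0) at_top"
    using lx ly
    by (auto intro!: continuous_on_tendsto_compose[OF contK]
        eventually_mono[OF eventually_gt_at_top[of 0]] simp: xy less_imp_le)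
  have lJ: "((\<lambda>r. J (x r)) \<longlongrightarrow> J 1) at_top" "((\<lambda>r. J (y r)) \<longlongrightarrow> J 0) at_top"
    using lx ly by (auto intro: isCont_tendsto_compose[OF contJ])
  have lr: "((\<lambda>r. 1 / r) \<longlongrightarrow> 0) (at_top :: real filter)"
    using tendsto_const_over_linear[of 1 1 0] by simp
  have "J 1 + J 0 - 2 * J c \<le> (K c / d - K 1 / d) * (0 + d / t) - (K c / d - K 0 / d) * (0 + d / s)"
  proof (rule tendsto_le)
    show "((\<lambda>r. J (x r) + J (y r) - 2 * J c) \<longlongrightarrow> J 1 + J 0 - 2 * J c) at_top"
      by (intro tendsto_intros lJ)
    show "((\<lambda>r. (K c / d - K (x r) / d) * (1 / r + d / t) - (K c / d - K (y r) / d) * (1 / r + d / s))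
      \<longlongrightarrow> (K c / d - K 1 / d) * (0 + d / t) - (K c / d - K 0 / d) * (0 + d / s)) at_top"
      using pos by (intro tendsto_intros lK lr) auto
    show "\<forall>\<^sub>F r in at_top. J (x r) + J (y r) - 2 * J c
      \<le> (K c / d - K (x r) / d) * (1 / r + d / t) - (K c / d - K (y r) / d) * (1 / r + d / s)"
      by (rule eventually_mono[OF eventually_gt_at_top[of 0] step])
  qed simp
  moreover have "J 1 = 1" "J 0 = 0" "K 0 = 0" "K 1 = 0"
    using pos by (simp_all add: J_def K_def reg_inc_beta_ends beta_kernel_ends)
  ultimately have "1 - 2 * J c \<le> K c / d * (d / t) - K c / d * (d / s)" by simp
  also have "\<dots> = (1 / t - 1 / s) * K c" using pos by (simp add: field_simps)
  finally show "1 \<le> equipoint_cdf s t (s / (s + t))"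
    using equipoint_cdf_eq[of s t c] pos by (simp add: J_def K_def c_def d_def)
qed (use assms in auto)

section \<open>The equipoint lies above the mean of the mixture\<close>

lemma equipoint_cdf_has_derivative:
  assumes "s > 0" "t > 0" "0 < x" "x < 1"
  shows "(equipoint_cdf s t has_real_derivative
    (s + t) / (s * t) * (s - (s - t) * x) * beta_density s t x) (at x)"
proof -
  note B = Beta_pos[OF assms(1,2)]
  note B1 = Beta_real_plus1[OF assms(1,2)]
  have "beta_density s (t + 1) x = (s + t) / t * (1 - x) * beta_density s t x"
    "beta_density (s + 1) t x = (s + t) / s * x * beta_density s t x"
    using assms B by (simp_all add: beta_density_def B1 powr_diff mult_ac)
  then have "beta_density s (t + 1) x + beta_density (s + 1) t x
      = ((s + t) / t * (1 - x) + (s + t) / s * x) * beta_density s t x"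
    by (simp add: distrib_right)
  also have "(s + t) / t * (1 - x) + (s + t) / s * x = (s + t) / (s * t) * (s - (s - t) * x)"
    using assms by (simp add: divide_simps) (simp add: algebra_simps)
  finally show ?thesis
    unfolding equipoint_cdf_def[abs_def] using assms
    by (auto intro!: derivative_eq_intros reg_inc_beta_has_derivative)
qed

text \<open>
  The kernel times a linear factor vanishes at both ends of the unit interval. If it is a primitive of
  \<open>- (x - \<mu>)\<close> times the mixture density, then \<open>\<mu>\<close> is the mean, and with this \<open>\<mu>\<close> a suitable linear factor exists.
\<close>
lemma equipoint_cdf_primitive_has_derivative:
  fixes s t x :: real
  assumes "s > 0" "t > 0" "0 < x" "x < 1"
  defines "\<mu> \<equiv> (s + 1 / 2) / (s + t + 1)"
  shows "((\<lambda>x. (s + t) / (s * t) * ((s - (s - t) * x + 1 / 2) / (s + t + 1)) * beta_kernel s t x)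
    has_real_derivative - (x - \<mu>) * ((s + t) / (s * t) * (s - (s - t) * x) * beta_density s t x)) (at x)"
proof -
  define e where "e = s + t + 1"
  have e: "e > 0" using assms by (simp add: e_def)
  have "- (s - t) / e * (x * (1 - x)) + (s - (s - t) * x + 1 / 2) / e * (s - (s + t) * x)
      = - (x - \<mu>) * (s - (s - t) * x)"
  proof -
    have "- (s - t) * (x * (1 - x)) + (s - (s - t) * x + 1 / 2) * (s - (s + t) * x)
      = - (e * x - (s + 1 / 2)) * (s - (s - t) * x)"
      unfolding e_def by (simp add: algebra_simps)
    moreover have "s + 1 / 2 = e * \<mu>" using e by (simp add: \<mu>_def flip: e_def)
    ultimately have "- (s - t) * (x * (1 - x)) + (s - (s - t) * x + 1 / 2) * (s - (s + t) * x)
      = e * (- (x - \<mu>) * (s - (s - t) * x))" by (simp add: algebra_simps)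
    moreover have "- (s - t) / e * X + Y / e * Z = (- (s - t) * X + Y * Z) / e" for X Y Z :: real
      by (simp only: add_divide_distrib times_divide_eq_left)
    ultimately show ?thesis using e by simp
  qed
  then have eq: "(s + t) / (s * t) * (- (s - t) / e * (x * (1 - x)) + (s - (s - t) * x + 1 / 2) / e * (s - (s + t) * x))
       * beta_density s t x
      = - (x - \<mu>) * ((s + t) / (s * t) * (s - (s - t) * x) * beta_density s t x)"
    by (simp only: mult_ac)
  have "((\<lambda>x. (s + t) / (s * t) * ((s - (s - t) * x + 1 / 2) / e) * beta_kernel s t x)
    has_real_derivative (s + t) / (s * t) * (- (s - t) / e) * beta_kernel s t x
      + ((s - (s + t) * x) * beta_density s t x) * ((s + t) / (s * t) * ((s - (s - t) * x + 1 / 2) / e))) (at x)"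
    using assms e
    by (intro DERIV_mult beta_kernel_has_derivative DERIV_cmult)
       (auto intro!: derivative_eq_intros)
  then show ?thesis
    unfolding eq[symmetric] e_def[symmetric] beta_kernel_eq_density[OF assms(3,4)]
    by (rule DERIV_cong) (simp only: ring_distribs mult_ac)
qed

text \<open>
  Up to a constant the two sides are the ratio of the mixture density to the primitive from
  \<open>equipoint_cdf_primitive_has_derivative\<close>, taken at points symmetric about the mean. The factor
  \<open>1 / (x (1 - x))\<close> favours the point on the right, as \<open>\<mu> \<ge> 1/2\<close>, the remaining factor the one on the left.
  After clearing denominators with \<open>e = s + t + 1\<close>, the difference is a positive multiple of an expression that
  is affine in \<open>W = (e v)\<^sup>2\<close>, so it suffices to check it at the two ends of the range of \<open>W\<close>.
\<close>
lemma equipoint_hazard_le: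
  fixes s t v :: real
  assumes "0 < t" "t \<le> s" "1 \<le> s"
  defines "\<mu> \<equiv> (s + 1 / 2) / (s + t + 1)"
  assumes v: "0 < v" "v < 1 - \<mu>"
  defines "x \<equiv> \<mu> + v" and "y \<equiv> \<mu> - v"
  shows "(s - (s - t) * y) / ((s - (s - t) * y + 1 / 2) * (y * (1 - y)))
    \<le> (s - (s - t) * x) / ((s - (s - t) * x + 1 / 2) * (x * (1 - x)))"
proof -
  define e D p W where "e = s + t + 1" and "D = s - t" and "p = 2 * s * t + (s + t) / 2" and "W = (e * v)\<^sup>2"
  have e: "e > 0" "e \<ge> 2" and D: "D \<ge> 0" using assms(1-3) by (auto simp: e_def D_def)
  have mu: "e * \<mu> = s + 1 / 2" "e * (1 - \<mu>) = t + 1 / 2" "0 < \<mu>" "\<mu> < 1"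
    using e assms(1-3) by (simp_all add: \<mu>_def e_def field_simps)
  have mu1: "1 - \<mu> \<le> \<mu>"
  proof -
    have "e * (1 - \<mu>) \<le> e * \<mu>" using mu(1,2) assms(2) by linarith
    then show ?thesis using e by (simp only: mult_le_cancel_left_pos)
  qed
  have xy: "0 < x" "x < 1" "0 < y" "y < 1" using mu(3,4) mu1 v by (auto simp: x_def y_def)
  have W: "0 \<le> W" "W \<le> (t + 1 / 2)\<^sup>2"
  proof -
    have "e * v \<le> e * (1 - \<mu>)" using v e by (intro mult_left_mono) auto
    then show "W \<le> (t + 1 / 2)\<^sup>2"
      unfolding W_def using e v mu(2) by (intro power_mono) auto
  qed (simp add: W_def)
  have st: "0 < s * t" "t * t \<le> s * t" using assms by (auto intro: mult_right_mono)
  \<comment> \<open>According to the sign of the coefficient of \<open>W\<close>, the least value is at \<open>W = 0\<close> or at the largest \<open>W\<close>.\<close>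
  have K: "0 \<le> 2 * p\<^sup>2 - 2 * D\<^sup>2 * W + e * (s * t - 1 / 4 + W)"
  proof (cases "2 * D\<^sup>2 \<le> e")
    case True
    have "1 / 4 * e \<le> 2 * ((s + t) / 2)\<^sup>2"
    proof -
      have "s + t \<le> (s + t) * (s + t)" using assms(1-3) mult_right_mono[of 1 "s + t" "s + t"] by simp
      then show ?thesis using assms(1-3) unfolding e_def power2_eq_square by (simp add: algebra_simps)
    qed
    also have "\<dots> \<le> 2 * p\<^sup>2"
      using st assms(1-3) unfolding p_def by (intro mult_left_mono power_mono) auto
    finally have "1 / 4 * e \<le> 2 * p\<^sup>2" .
    moreover have "0 \<le> (e - 2 * D\<^sup>2) * W" using True W by simp
    moreover have "0 \<le> e * (s * t)" using e st by simp
    ultimately show ?thesis by (simp add: algebra_simps)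
  next
    case False
    have "(2 * D\<^sup>2 - e) * W \<le> (2 * D\<^sup>2 - e) * (t + 1 / 2)\<^sup>2"
      using False W by (intro mult_left_mono) auto
    moreover have "2 * p\<^sup>2 - 2 * D\<^sup>2 * (t + 1 / 2)\<^sup>2 + e * (s * t - 1 / 4 + (t + 1 / 2)\<^sup>2)
      = e * t * (2 * (3 * (s * t) - t * t + s) + e)"
      unfolding p_def D_def e_def power2_eq_square by (simp add: field_simps)
    moreover have "0 \<le> e * t * (2 * (3 * (s * t) - t * t + s) + e)"
      using e st assms(1-3) by (intro mult_nonneg_nonneg) auto
    ultimately show ?thesis by (simp add: algebra_simps)
  qed
  define zx zy where "zx = s - D * x" and "zy = s - D * y"
  have ez: "e * zx = p - D * (e * v)" "e * zy = p + D * (e * v)"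
  proof -
    have "e * s - D * (s + 1 / 2) = p" by (simp add: p_def e_def D_def field_simps)
    then show "e * zx = p - D * (e * v)" "e * zy = p + D * (e * v)"
      unfolding zx_def zy_def x_def y_def mu(1)[symmetric] by (simp_all add: algebra_simps)
  qed
  have zpos: "0 < zx" "0 < zy"
  proof -
    have "D * x \<le> D" "D * y \<le> D" using D xy by (auto intro: mult_left_le)
    then show "0 < zx" "0 < zy" using assms(1) by (auto simp: zx_def zy_def D_def)
  qed
  have ex: "e * x = s + 1 / 2 + e * v" "e * (1 - x) = t + 1 / 2 - e * v"
    "e * y = s + 1 / 2 - e * v" "e * (1 - y) = t + 1 / 2 + e * v"
    using mu(1,2) by (simp_all add: x_def y_def algebra_simps)
  have "e ^ 4 * (zx * (zy + h) * (y * (1 - y)) - zy * (zx + h) * (x * (1 - x)))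
     = (e * zx) * (e * zy + e * h) * ((e * y) * (e * (1 - y)))
      - (e * zy) * (e * zx + e * h) * ((e * x) * (e * (1 - x)))" for h
    by (simp add: algebra_simps power4_eq_xxxx)
  from this[of "1 / 2"]
  have "e ^ 4 * (zx * (zy + 1 / 2) * (y * (1 - y)) - zy * (zx + 1 / 2) * (x * (1 - x)))
     = (e * zx) * (e * zy + e * (1 / 2)) * ((e * y) * (e * (1 - y)))
      - (e * zy) * (e * zx + e * (1 / 2)) * ((e * x) * (e * (1 - x)))" .
  also have "\<dots> = D * (e * v) * (2 * p\<^sup>2 - 2 * D\<^sup>2 * W + e * (s * t - 1 / 4 + W))"
    unfolding ez ex by (simp add: W_def p_def D_def power2_eq_square field_simps)
  also have "\<dots> \<ge> 0"
    using K D e v by (intro mult_nonneg_nonneg) auto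
  finally have "zy * (zx + 1 / 2) * (x * (1 - x)) \<le> zx * (zy + 1 / 2) * (y * (1 - y))"
    using e by (simp add: zero_le_mult_iff)
  then show ?thesis
    using zpos xy unfolding D_def[symmetric] zx_def[symmetric] zy_def[symmetric]
    by (simp add: divide_simps mult_ac)
qed

text \<open>
  The mean of the left-skewed mixture is at most its median. Here \<open>\<kappa> = \<eta> = 0\<close>, so that the compared points are
  \<open>\<mu> + r\<close> and \<open>\<mu> - r\<close>. The primitive \<open>Q\<close> is smaller at \<open>\<mu> + r\<close>: its logarithmic derivative is
  \<open>- (x - \<mu>)\<close> times the ratio \<open>f / Q\<close>, and by \<open>equipoint_hazard_le\<close> it falls faster on the right. The
  right-hand point reaches 1 first, at \<open>r = \<rho> = 1 - \<mu>\<close>. The mass left over in \<open>[0, \<mu> - \<rho>]\<close> lies at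
  distance at least \<open>\<rho>\<close> from \<open>\<mu>\<close> and is therefore at most \<open>Q (\<mu> - \<rho>) / \<rho>\<close>, which is the boundary term of
  the comparison.
\<close>
lemma mean_le_equipoint:
  assumes "0 < t" "t \<le> s" "1 \<le> s"
  shows "(s + 1 / 2) / (s + t + 1) \<le> equipoint s t"
proof (rule equipoint_ge)
  define \<mu> where "\<mu> = (s + 1 / 2) / (s + t + 1)"
  define K where "K = beta_kernel s t"
  define Q where "Q = (\<lambda>x. (s + t) / (s * t) * ((s - (s - t) * x + 1 / 2) / (s + t + 1)) * K x)"
  define f where "f = (\<lambda>x. (s + t) / (s * t) * (s - (s - t) * x) * beta_density s t x)"
  have pos: "0 < s" "0 < t" using assms by auto
  have "1 / 2 \<le> \<mu>"
    unfolding \<mu>_def using assms by (subst pos_le_divide_eq) auto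
  moreover have "\<mu> < 1" unfolding \<mu>_def using assms by (subst pos_divide_less_eq) auto
  ultimately have mu: "0 < \<mu>" "\<mu> < 1" "1 - \<mu> \<le> \<mu>" by auto
  then show "(s + 1 / 2) / (s + t + 1) \<le> 1" by (simp add: \<mu>_def)
  have z: "0 < s - (s - t) * x" if "0 \<le> x" "x \<le> 1" for x
  proof -
    have "(s - t) * x \<le> (s - t) * 1" using that assms by (intro mult_left_mono) auto
    with assms show ?thesis by simp
  qed
  have K_pos: "0 < K x" if "0 < x" "x < 1" for x
    unfolding K_def beta_kernel_def using that Beta_pos pos by simp
  have f_nonneg: "0 \<le> f x" if "0 < x" "x < 1" for x
    unfolding f_def using pos z[of x] that by (intro mult_nonneg_nonneg beta_density_nonneg) auto
  have Q_pos: "0 < Q x" if "0 < x" "x < 1" for x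
    unfolding Q_def using pos z[of x] that K_pos by (intro mult_pos_pos divide_pos_pos) auto
  have M': "(equipoint_cdf s t has_real_derivative f x) (at x)"
    and Q': "(Q has_real_derivative - (x - \<mu>) * f x) (at x)" if "0 < x" "x < 1" for x
    unfolding f_def Q_def \<mu>_def K_def
    using equipoint_cdf_has_derivative equipoint_cdf_primitive_has_derivative pos that by auto
  have ends: "equipoint_cdf s t 0 = 0" "equipoint_cdf s t 1 = 2" "Q 0 = 0" "Q 1 = 0"
    using pos by (simp_all add: equipoint_cdf_def Q_def K_def reg_inc_beta_ends beta_kernel_ends)
  have contM: "continuous_on {0..1} (equipoint_cdf s t)"
    unfolding equipoint_cdf_def[abs_def] using pos isCont_reg_inc_beta
    by (intro continuous_on_add) (auto intro: continuous_at_imp_continuous_on)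
  have contQ: "continuous_on {0..1} Q"
    unfolding Q_def K_def using pos by (intro continuous_intros continuous_on_beta_kernel) auto
  have hazard: "f x / Q x = (s + t + 1) * ((s - (s - t) * x) / ((s - (s - t) * x + 1 / 2) * (x * (1 - x))))"
    if "0 < x" "x < 1" for x
  proof -
    have "beta_density s t x > 0"
      using K_pos[OF that] that zero_less_mult_pos[of "x * (1 - x)" "beta_density s t x"]
      by (simp add: K_def beta_kernel_eq_density)
    then show ?thesis
      using that pos by (simp add: f_def Q_def K_def beta_kernel_eq_density)
  qed
  have reflected: "Q (\<mu> + v) \<le> Q (\<mu> - v)" if v: "0 < v" "v < 1 - \<mu>" for v
  proof -
    define R where "R = (\<lambda>v. ln (Q (\<mu> + v)) - ln (Q (\<mu> - v)))"
    have "R v \<le> R 0"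
    proof (rule DERIV_nonpos_imp_nonincreasing[OF less_imp_le[OF v(1)]])
      fix w assume w: "0 \<le> w" "w \<le> v"
      have dom: "0 < \<mu> + w" "\<mu> + w < 1" "0 < \<mu> - w" "\<mu> - w < 1" using w v mu by auto
      have "((\<lambda>v. Q (\<mu> + v)) has_real_derivative - (\<mu> + w - \<mu>) * f (\<mu> + w) * 1) (at w)"
        "((\<lambda>v. Q (\<mu> - v)) has_real_derivative - (\<mu> - w - \<mu>) * f (\<mu> - w) * (- 1)) (at w)"
        by (rule DERIV_chain2[where f = Q] Q' dom | force intro!: derivative_eq_intros)+
      then have "(R has_real_derivative 1 / Q (\<mu> + w) * (- w * f (\<mu> + w))
          - 1 / Q (\<mu> - w) * (- w * f (\<mu> - w))) (at w)"
        unfolding R_def using dom Q_pos[of "\<mu> + w"] Q_pos[of "\<mu> - w"]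
        by (intro DERIV_diff DERIV_ln_divide[THEN DERIV_chain2]) auto
      then have "(R has_real_derivative w * (f (\<mu> - w) / Q (\<mu> - w) - f (\<mu> + w) / Q (\<mu> + w))) (at w)"
        by (rule DERIV_cong) (simp add: algebra_simps)
      moreover have "w * (f (\<mu> - w) / Q (\<mu> - w) - f (\<mu> + w) / Q (\<mu> + w)) \<le> 0"
      proof (cases "w = 0")
        case False
        then have "f (\<mu> - w) / Q (\<mu> - w) \<le> f (\<mu> + w) / Q (\<mu> + w)"
          unfolding hazard[OF dom(1,2)] hazard[OF dom(3,4)]
          using equipoint_hazard_le[OF assms, of w] w v assms
          by (intro mult_left_mono) (auto simp: \<mu>_def)
        with w show ?thesis by (simp add: mult_nonneg_nonpos)
      qed simp
      ultimately show "\<exists>y. (R has_real_derivative y) (at w) \<and> y \<le> 0" by blast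
    qed
    then have "ln (Q (\<mu> + v)) \<le> ln (Q (\<mu> - v))" by (simp add: R_def)
    then show ?thesis using Q_pos[of "\<mu> + v"] Q_pos[of "\<mu> - v"] v mu by simp
  qed
  define \<rho> where "\<rho> = 1 - \<mu>"
  have step: "(Q (\<mu> - r) - Q (\<mu> + r)) / r \<le> equipoint_cdf s t (\<mu> + r) + equipoint_cdf s t (\<mu> - r) - 2 * equipoint_cdf s t \<mu>"
    if r: "0 < r" "r < \<rho>" for r
  proof -
    \<comment> \<open>The comparison is applied to the negatives, since \<open>Q\<close> is larger on the left here.\<close>
    have "- equipoint_cdf s t (\<mu> + r / (1 + 0 * r)) + - equipoint_cdf s t (\<mu> - r / (1 + 0 * r)) - 2 * - equipoint_cdf s t \<mu>
      \<le> (- Q \<mu> - - Q (\<mu> + r / (1 + 0 * r))) * (1 / r + 0) - (- Q \<mu> - - Q (\<mu> - r / (1 + 0 * r))) * (1 / r + 0)"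
    proof (rule bisected_mass_comparison[where l = 0 and u = 1 and a = "\<lambda>x. - f x"])
      fix z :: real assume z: "0 < z" "z < 1"
      show "((\<lambda>x. - equipoint_cdf s t x) has_real_derivative - f z) (at z)"
        using M'[OF z] by (rule DERIV_minus)
      show "((\<lambda>x. - Q x) has_real_derivative - (z - \<mu>) * - f z) (at z)"
        using DERIV_minus[OF Q'[OF z]] by simp
    qed (use r mu reflected in \<open>auto simp: \<rho>_def\<close>)
    then show ?thesis by (simp add: diff_divide_distrib)
  qed
  have rho: "0 < \<rho>" "\<rho> \<le> \<mu>" "\<mu> + \<rho> = 1" using mu by (auto simp: \<rho>_def)
  have lim: "((\<lambda>r. g (\<mu> + r)) \<longlongrightarrow> g (\<mu> + \<rho>)) (at_left \<rho>)" "((\<lambda>r. g (\<mu> - r)) \<longlongrightarrow> g (\<mu> - \<rho>)) (at_left \<rho>)"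
    if "continuous_on {0..1} g" for g :: "real \<Rightarrow> real"
  proof -
    have "continuous_on {0..\<rho>} (\<lambda>r. g (\<mu> + r))" "continuous_on {0..\<rho>} (\<lambda>r. g (\<mu> - r))"
      using mu by (auto intro!: continuous_on_compose2[OF that] continuous_intros simp: \<rho>_def)
    then show "((\<lambda>r. g (\<mu> + r)) \<longlongrightarrow> g (\<mu> + \<rho>)) (at_left \<rho>)" "((\<lambda>r. g (\<mu> - r)) \<longlongrightarrow> g (\<mu> - \<rho>)) (at_left \<rho>)"
      using rho by (auto dest: continuous_on_Icc_at_leftD)
  qed
  have "(Q (\<mu> - \<rho>) - Q (\<mu> + \<rho>)) / \<rho> \<le> equipoint_cdf s t (\<mu> + \<rho>) + equipoint_cdf s t (\<mu> - \<rho>) - 2 * equipoint_cdf s t \<mu>"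
  proof (rule tendsto_le)
    show "((\<lambda>r. equipoint_cdf s t (\<mu> + r) + equipoint_cdf s t (\<mu> - r) - 2 * equipoint_cdf s t \<mu>)
      \<longlongrightarrow> equipoint_cdf s t (\<mu> + \<rho>) + equipoint_cdf s t (\<mu> - \<rho>) - 2 * equipoint_cdf s t \<mu>) (at_left \<rho>)"
      by (intro tendsto_intros lim contM)
    show "((\<lambda>r. (Q (\<mu> - r) - Q (\<mu> + r)) / r) \<longlongrightarrow> (Q (\<mu> - \<rho>) - Q (\<mu> + \<rho>)) / \<rho>) (at_left \<rho>)"
      using rho by (intro tendsto_intros lim contQ) auto
    show "\<forall>\<^sub>F r in at_left \<rho>. (Q (\<mu> - r) - Q (\<mu> + r)) / r
      \<le> equipoint_cdf s t (\<mu> + r) + equipoint_cdf s t (\<mu> - r) - 2 * equipoint_cdf s t \<mu>"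
      using rho step by (auto simp: eventually_at_left intro!: exI[of _ 0])
  qed simp
  then have main: "Q (\<mu> - \<rho>) / \<rho> \<le> 2 + equipoint_cdf s t (\<mu> - \<rho>) - 2 * equipoint_cdf s t \<mu>"
    using rho by (simp add: ends)
  have tail: "equipoint_cdf s t (\<mu> - \<rho>) \<le> Q (\<mu> - \<rho>) / \<rho>"
  proof (cases "\<mu> = \<rho>")
    case False
    have "equipoint_cdf s t (\<mu> - \<rho>) - Q (\<mu> - \<rho>) / \<rho> \<le> equipoint_cdf s t 0 - Q 0 / \<rho>"
    proof (rule DERIV_nonpos_imp_decreasing_open[where f = "\<lambda>x. equipoint_cdf s t x - Q x / \<rho>"])
      fix x assume x: "0 < x" "x < \<mu> - \<rho>"
      with mu rho have x1: "x < 1" by linarith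
      have "((\<lambda>x. equipoint_cdf s t x - Q x / \<rho>) has_real_derivative f x - - (x - \<mu>) * f x / \<rho>) (at x)"
        using x x1 by (intro DERIV_diff DERIV_cdivide M' Q')
      moreover have "f x - - (x - \<mu>) * f x / \<rho> = f x * ((\<rho> - (\<mu> - x)) / \<rho>)"
        using rho by (simp add: field_simps)
      moreover have "f x * ((\<rho> - (\<mu> - x)) / \<rho>) \<le> 0"
        using x x1 rho by (intro mult_nonneg_nonpos f_nonneg divide_nonpos_pos) auto
      ultimately show "\<exists>y. ((\<lambda>x. equipoint_cdf s t x - Q x / \<rho>) has_real_derivative y) (at x) \<and> y \<le> 0" by auto
    next
      have "{0..\<mu> - \<rho>} \<subseteq> {0..1}" using mu rho by auto
      then show "continuous_on {0..\<mu> - \<rho>} (\<lambda>x. equipoint_cdf s t x - Q x / \<rho>)"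
        using rho by (intro continuous_intros continuous_on_subset[OF contM] continuous_on_subset[OF contQ]) auto
    qed (use rho in auto)
    then show ?thesis by (simp add: ends)
  qed (simp add: ends)
  from main tail show "equipoint_cdf s t ((s + 1 / 2) / (s + t + 1)) \<le> 1"
    unfolding \<mu>_def[symmetric] by linarith
qed (use assms in auto)

section \<open>Comparing the kernels for neighbouring parameters\<close>

lemma ln_bounds_around_one:
  fixes h :: real
  assumes "0 \<le> h" "h < 1"
  shows "h\<^sup>2 \<le> (1 + h) * ln (1 + h) + (1 - h) * ln (1 - h)"
    and "- h - h\<^sup>2 / 2 \<le> ln (1 - h / 2) - ln (1 + h / 2)"
    and "h\<^sup>2 \<le> - (ln (1 + h) + ln (1 - h))"
proof -
  define g where "g = (\<lambda>h::real. (1 + h) * ln (1 + h) + (1 - h) * ln (1 - h) - h\<^sup>2)"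
  define g1 where "g1 = (\<lambda>h::real. ln (1 + h) - ln (1 - h) - 2 * h)"
  have g1: "0 \<le> g1 w" if "0 \<le> w" "w < 1" for w
  proof -
    have "g1 0 \<le> g1 w"
    proof (rule DERIV_nonneg_imp_nondecreasing[OF that(1)])
      fix x assume x: "0 \<le> x" "x \<le> w"
      with that have p: "0 < 1 + x" "0 < 1 - x" by auto
      have "(g1 has_real_derivative 1 / (1 + x) + 1 / (1 - x) - 2) (at x)"
        unfolding g1_def using p by (auto intro!: derivative_eq_intros)
      moreover have "1 / (1 + x) + 1 / (1 - x) = 2 / ((1 + x) * (1 - x))"
        using p by (simp add: field_simps)
      moreover have "2 \<le> 2 / ((1 + x) * (1 - x))"
        using p mult_pos_pos[OF p] by (subst pos_le_divide_eq) (simp_all add: algebra_simps)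
      ultimately show "\<exists>y. (g1 has_real_derivative y) (at x) \<and> 0 \<le> y" by auto
    qed
    then show ?thesis by (simp add: g1_def)
  qed
  have "g 0 \<le> g h"
  proof (rule DERIV_nonneg_imp_nondecreasing[OF assms(1)])
    fix x assume x: "0 \<le> x" "x \<le> h"
    with assms have p: "0 < 1 + x" "0 < 1 - x" by auto
    have "(g has_real_derivative g1 x) (at x)"
      unfolding g_def g1_def using p by (auto intro!: derivative_eq_intros)
    then show "\<exists>y. (g has_real_derivative y) (at x) \<and> 0 \<le> y"
      using g1[of x] x assms by auto
  qed
  then show "h\<^sup>2 \<le> (1 + h) * ln (1 + h) + (1 - h) * ln (1 - h)" by (simp add: g_def)
  define k where "k = (\<lambda>h::real. ln (1 - h / 2) - ln (1 + h / 2) + h + h\<^sup>2 / 2)"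
  have "k 0 \<le> k h"
  proof (rule DERIV_nonneg_imp_nondecreasing[OF assms(1)])
    fix x assume x: "0 \<le> x" "x \<le> h"
    with assms have p: "0 < 2 + x" "0 < 2 - x" "x < 1" by auto
    have "(k has_real_derivative - ((1 / 2) / (1 - x / 2)) - (1 / 2) / (1 + x / 2) + 1 + x) (at x)"
      unfolding k_def using p by (auto intro!: derivative_eq_intros)
    moreover have "(1 / 2) / (1 - x / 2) = 1 / (2 - x)" "(1 / 2) / (1 + x / 2) = 1 / (2 + x)"
      using p by (simp_all add: field_simps)
    moreover have "- (1 / (2 - x)) - 1 / (2 + x) + 1 + x = x * (4 - x - x\<^sup>2) / ((2 - x) * (2 + x))"
      using p by (simp add: divide_simps power2_eq_square) (simp add: algebra_simps)
    moreover have "x\<^sup>2 \<le> 1" using x p by (simp add: power_le_one)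
    then have "0 \<le> x * (4 - x - x\<^sup>2) / ((2 - x) * (2 + x))"
      using p x by (intro divide_nonneg_nonneg mult_nonneg_nonneg) auto
    ultimately show "\<exists>y. (k has_real_derivative y) (at x) \<and> 0 \<le> y" by auto
  qed
  then show "- h - h\<^sup>2 / 2 \<le> ln (1 - h / 2) - ln (1 + h / 2)" by (simp add: k_def)
  have "ln ((1 + h) * (1 - h)) \<le> (1 + h) * (1 - h) - 1"
    using assms by (intro ln_le_minus_one mult_pos_pos) auto
  moreover have "ln ((1 + h) * (1 - h)) = ln (1 + h) + ln (1 - h)"
    using assms by (subst ln_mult) auto
  ultimately show "h\<^sup>2 \<le> - (ln (1 + h) + ln (1 - h))"
    by (simp add: power2_eq_square algebra_simps)
qed

text \<open>
  The logarithm of the right side of \<open>kernel_step_le\<close> divided by the left side.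
\<close>
definition step_excess :: "real \<Rightarrow> real \<Rightarrow> real" where
  "step_excess t s = (s + 1) * ln (s + 3 / 2) + (t - 1) * ln (t - 1 / 2)
     + (s + t) * ln (s + t) - (s + t) * ln (s + t + 1) - s * ln s - (t - 1) * ln t - ln (s + 1)"

text \<open>
  In terms of \<open>a = t + 1/2\<close> and \<open>h = 1/a\<close> the expression consists of second differences of
  \<open>x ln x\<close> and of \<open>ln x\<close> with step 1 at \<open>a\<close>, and one first difference of \<open>ln x\<close>. Their leading terms
  \<open>h\<close> and \<open>- h\<close> cancel, and the bounds of \<open>ln_bounds_around_one\<close> are just sharp enough for the terms
  \<open>h\<^sup>2 / 2\<close> to cancel as well.
\<close>
lemma step_excess_diag:
  assumes "1 < t"
  shows "0 \<le> step_excess t t"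
proof -
  define a h where "a = t + 1 / 2" and "h = 1 / a"
  have a: "a > 3 / 2" using assms by (simp add: a_def)
  have h: "0 < h" "h < 1" using a by (auto simp: h_def)
  have ah: "a * h = 1" using a by (simp add: h_def)
  have eqs: "t + 3 / 2 = a * (1 + h)" "t - 1 / 2 = a * (1 - h)" "t = a * (1 - h / 2)"
    "t + 1 = a * (1 + h / 2)" "t + t + 1 = 2 * a"
  proof -
    have *: "a * (1 + h) = a + 1" "a * (1 - h) = a - 1" "a * (1 - h / 2) = a - 1 / 2"
      "a * (1 + h / 2) = a + 1 / 2"
      using ah by (simp_all add: distrib_left right_diff_distrib)
    show "t + 3 / 2 = a * (1 + h)" "t - 1 / 2 = a * (1 - h)" "t = a * (1 - h / 2)"
      "t + 1 = a * (1 + h / 2)" "t + t + 1 = 2 * a"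
      unfolding * by (simp_all add: a_def)
  qed
  have logs: "ln (t + 3 / 2) = ln a + ln (1 + h)" "ln (t - 1 / 2) = ln a + ln (1 - h)"
    "ln t = ln a + ln (1 - h / 2)" "ln (t + 1) = ln a + ln (1 + h / 2)" "ln (t + t + 1) = ln 2 + ln a"
    "ln (t + t) = ln 2 + ln t"
  proof -
    show "ln (t + 3 / 2) = ln a + ln (1 + h)" by (subst eqs(1)) (use a h in \<open>simp add: ln_mult\<close>)
    show "ln (t - 1 / 2) = ln a + ln (1 - h)" by (subst eqs(2)) (use a h in \<open>simp add: ln_mult\<close>)
    show "ln t = ln a + ln (1 - h / 2)" by (subst eqs(3)) (use a h in \<open>simp add: ln_mult\<close>)
    show "ln (t + 1) = ln a + ln (1 + h / 2)" by (subst eqs(4)) (use a h in \<open>simp add: ln_mult\<close>)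
    show "ln (t + t + 1) = ln 2 + ln a" by (subst eqs(5)) (use a in \<open>simp add: ln_mult\<close>)
    show "ln (t + t) = ln 2 + ln t" using assms ln_mult[of 2 t] by simp
  qed
  have "step_excess t t = (a + 1 / 2) * ln (1 + h) + (a - 3 / 2) * ln (1 - h)
      + ln (1 - h / 2) - ln (1 + h / 2)"
    unfolding step_excess_def logs by (simp add: a_def algebra_simps)
  also have "\<dots> = a * ((1 + h) * ln (1 + h) + (1 - h) * ln (1 - h))
      - (ln (1 + h) + ln (1 - h)) / 2 + (ln (1 - h / 2) - ln (1 + h / 2))"
  proof -
    have "a * ((1 + h) * x + (1 - h) * y) = (a + a * h) * x + (a - a * h) * y" for x y
      by (simp add: algebra_simps)
    then have *: "a * ((1 + h) * x + (1 - h) * y) = (a + 1) * x + (a - 1) * y" for x y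
      by (simp only: ah)
    show ?thesis unfolding * by (simp add: field_simps)
  qed
  also have "\<dots> \<ge> a * h\<^sup>2 + h\<^sup>2 / 2 + (- h - h\<^sup>2 / 2)"
  proof -
    have nn: "0 \<le> h" "0 \<le> a" using h a by auto
    have "x' \<le> x \<Longrightarrow> y' \<le> - y \<Longrightarrow> z' \<le> z \<Longrightarrow> x' + y' / 2 + z' \<le> x - y / 2 + z"
      for x x' y y' z z' :: real by linarith
    then show ?thesis
      using ln_bounds_around_one[OF nn(1) h(2)] nn(2) by (blast intro: mult_left_mono)
  qed
  also have "a * h\<^sup>2 = h" using ah by (simp add: power2_eq_square mult.assoc[symmetric])
  finally show ?thesis by simp
qed

text \<open>
  The expression increases with \<open>s\<close>, which leaves the diagonal case. In its derivative the terms depending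
  on \<open>s + t\<close> form a decreasing function \<open>b\<close>. Replacing \<open>s + t\<close> by \<open>s\<close> there reduces the claim to a single
  instance of \<open>ln u \<le> u - 1\<close>.
\<close>
lemma step_excess_nonneg:
  assumes "1 < t" "t \<le> s"
  shows "0 \<le> step_excess t s"
proof -
  have "step_excess t t \<le> step_excess t s"
  proof (rule DERIV_nonneg_imp_nondecreasing[OF assms(2)])
    fix w assume w: "t \<le> w" "w \<le> s"
    with assms have w0: "0 < w" "0 < t" by auto
    define D where "D = ln (w + 3 / 2) + (w + 1) / (w + 3 / 2) + ln (w + t) - ln (w + t + 1)
        - (w + t) / (w + t + 1) - ln w - 1 / (w + 1)"
    have "(step_excess t has_real_derivative D) (at w)"
      unfolding step_excess_def[abs_def] D_def using w0
      by (auto intro!: derivative_eq_intros)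
    moreover have "0 \<le> D"
    proof -
      have lb: "(y - x) / y \<le> ln y - ln x" if "0 < x" "0 < y" for x y :: real
      proof -
        have "ln (x / y) \<le> x / y - 1" using that by (intro ln_le_minus_one) auto
        then show ?thesis using that by (simp add: ln_div diff_divide_distrib)
      qed
      define b where "b = (\<lambda>x::real. ln (x + 1) - ln x - 1 / (x + 1))"
      have "b (w + t) \<le> b w"
      proof (rule DERIV_nonpos_imp_nonincreasing[where f = b])
        fix x assume "w \<le> x" "x \<le> w + t"
        with w0 have x: "0 < x" by simp
        have "(b has_real_derivative 1 / (x + 1) - 1 / x + 1 / (x + 1)\<^sup>2) (at x)"
          unfolding b_def using x
          by (auto intro!: derivative_eq_intros simp: power2_eq_square)
        moreover have "1 / (x + 1) - 1 / x + 1 / (x + 1)\<^sup>2 = - 1 / (x * (x + 1)\<^sup>2)"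
          using x by (simp add: divide_simps power2_eq_square; simp add: algebra_simps)
        moreover have "- 1 / (x * (x + 1)\<^sup>2) \<le> 0" using x by simp
        ultimately show "\<exists>y. (b has_real_derivative y) (at x) \<and> y \<le> 0" by auto
      qed (use w0 in simp)
      moreover have "D = ln (w + 3 / 2) - ln w + (w + 1) / (w + 3 / 2) - 1 / (w + 1) - 1 - b (w + t)"
      proof -
        have "(w + t) / (w + t + 1) = 1 - 1 / (w + t + 1)" using w0 by (simp add: field_simps)
        then show ?thesis by (simp add: D_def b_def)
      qed
      moreover have "b w = ln (w + 1) - ln w - 1 / (w + 1)"
        by (simp add: b_def)
      moreover have "(w + 1) / (w + 3 / 2) = 1 - (1 / 2) / (w + 3 / 2)"
        using w0 by (simp add: field_simps)
      moreover have "(1 / 2) / (w + 3 / 2) \<le> ln (w + 3 / 2) - ln (w + 1)"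
        using lb[of "w + 1" "w + 3 / 2"] w0 by simp
      ultimately show ?thesis by linarith
    qed
    ultimately show "\<exists>y. (step_excess t has_real_derivative y) (at w) \<and> 0 \<le> y" by blast
  qed
  with step_excess_diag[OF assms(1)] show ?thesis by simp
qed

text \<open>
  The left side is the largest possible weight at \<open>s\<close>, the right side the weight at \<open>s + 1\<close>, taken at the lower
  bound for the new equipoint. The Beta functions differ by the rational factor \<open>s / (t - 1)\<close> only,
  so after taking logarithms this is \<open>step_excess_nonneg\<close>.
\<close>
lemma kernel_step_le:
  assumes "1 < t" "t \<le> s"
  shows "(1 / s + 1 / t) * beta_kernel s t (s / (s + t))
    \<le> (1 / (s + 1) + 1 / (t - 1)) * beta_kernel (s + 1) (t - 1) ((s + 3 / 2) / (s + t + 1))"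
proof -
  define d e where "d = s + t" and "e = s + t + 1"
  have pos: "0 < s" "0 < t" "0 < t - 1" "0 < d" "0 < e" "0 < t - 1 / 2" "0 < s + 3 / 2"
    using assms by (auto simp: d_def e_def)
  have B: "Beta s t > 0" using Beta_pos pos by auto
  have B1: "Beta (s + 1) (t - 1) = s / (t - 1) * Beta s t"
  proof -
    have "Beta (s + 1) (t - 1) = s / (s + (t - 1)) * Beta s (t - 1)"
      "Beta s t = (t - 1) / (s + (t - 1)) * Beta s (t - 1)"
      using Beta_real_plus1[of s "t - 1"] pos by simp_all
    then show ?thesis using pos by simp
  qed
  have c: "1 - s / d = t / d" "1 - (s + 3 / 2) / e = (t - 1 / 2) / e"
    using pos by (simp_all add: d_def e_def field_simps)
  have "ln (s + 1) + s * (ln s - ln d) + t * (ln t - ln d)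
      \<le> ln t + (s + 1) * (ln (s + 3 / 2) - ln e) + (t - 1) * (ln (t - 1 / 2) - ln e)"
    using step_excess_nonneg[OF assms] unfolding step_excess_def d_def e_def
    by (simp add: algebra_simps)
  then have "exp (ln (s + 1) + s * (ln s - ln d) + t * (ln t - ln d))
      \<le> exp (ln t + (s + 1) * (ln (s + 3 / 2) - ln e) + (t - 1) * (ln (t - 1 / 2) - ln e))" by simp
  then have key: "(s + 1) * ((s / d) powr s * (t / d) powr t)
      \<le> t * (((s + 3 / 2) / e) powr (s + 1) * ((t - 1 / 2) / e) powr (t - 1))"
    using pos by (simp add: exp_add powr_def ln_div mult.assoc)
  have "(1 / s + 1 / t) * beta_kernel s t (s / d)
     = d / (s * t * (s + 1) * Beta s t) * ((s + 1) * ((s / d) powr s * (t / d) powr t))"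
  proof -
    have "1 / s + 1 / t = d / (s * t)" using pos by (simp add: d_def field_simps)
    then show ?thesis using pos B by (simp add: beta_kernel_def c)
  qed
  also have "\<dots> \<le> d / (s * t * (s + 1) * Beta s t)
      * (t * (((s + 3 / 2) / e) powr (s + 1) * ((t - 1 / 2) / e) powr (t - 1)))"
    using pos B by (intro mult_left_mono key) auto
  also have "\<dots> = (1 / (s + 1) + 1 / (t - 1)) * beta_kernel (s + 1) (t - 1) ((s + 3 / 2) / e)"
  proof -
    have "1 / (s + 1) + 1 / (t - 1) = d / ((s + 1) * (t - 1))"
      using pos by (simp add: d_def field_simps)
    then show ?thesis using pos B unfolding beta_kernel_def c B1 by simp
  qed
  finally show ?thesis unfolding d_def e_def .
qed

lemma Phi_step:
  assumes "1 < t" "t \<le> s"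
  shows "Phi (s + t) s \<le> Phi (s + t) (s + 1)"
proof -
  define e' where "e' = equipoint (s + 1) (t - 1)"
  have "(1 / s + 1 / t) * beta_kernel s t (equipoint s t) \<le> (1 / s + 1 / t) * beta_kernel s t (s / (s + t))"
    using assms equipoint[of s t] by (intro mult_left_mono beta_kernel_le_max) auto
  also have "\<dots> \<le> (1 / (s + 1) + 1 / (t - 1)) * beta_kernel (s + 1) (t - 1) ((s + 3 / 2) / (s + t + 1))"
    by (rule kernel_step_le[OF assms])
  also have "\<dots> \<le> (1 / (s + 1) + 1 / (t - 1)) * beta_kernel (s + 1) (t - 1) e'"
  proof (intro mult_left_mono beta_kernel_mono_below_max)
    show "(s + 3 / 2) / (s + t + 1) \<le> e'"
      using mean_le_equipoint[of "t - 1" "s + 1"] assms by (simp add: e'_def add.commute)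
    show "e' \<le> (s + 1) / (s + 1 + (t - 1))"
      using equipoint_le_mean[of "t - 1" "s + 1"] assms by (simp add: e'_def)
  qed (use assms in auto)
  finally show ?thesis
    using Phi_eq[of s t] Phi_eq[of "s + 1" "t - 1"] assms by (simp add: e'_def)
qed

theorem theorem1p15:
  fixes d :: real
  assumes "0 < d"
  shows "(\<forall>s::real. d / 2 \<le> s \<and> s < d - 1 \<longrightarrow> Phi_hat d s \<le> Phi_hat d (s + 1)) \<and>
    (\<forall>s::real. s \<in> half_Nats \<and> d \<in> half_Nats \<and> d / 2 \<le> s \<and> s < d - 1
       \<longrightarrow> Phi d s \<le> Phi d (s + 1))"
proof (intro conjI allI impI)
  fix s assume "d / 2 \<le> s \<and> s < d - 1"
  then show "Phi_hat d s \<le> Phi_hat d (s + 1)"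
    using Phi_hat_step[of "d - s" s] by (simp add: Phi_hat_def)
next
  fix s assume "s \<in> half_Nats \<and> d \<in> half_Nats \<and> d / 2 \<le> s \<and> s < d - 1"
  then show "Phi d s \<le> Phi d (s + 1)"
    using Phi_step[of "d - s" s] by simp
qed

end
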